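(* Consider the special case of $mR\{\text{1 or all}\}D$ (each demand $d$ has $|M_d|=1$ or $M_d=R$) in which all travel times are zero, all service times are infinite, and all demands have the same service start time. This special case is solvable (an optimal solution can be computed) in polynomial time.
   Context: Problem $mRmD$ (heterogeneous multi-resource allocation with subset demand requests). An instance consists of: a finite set $D$ of demands; a finite set $R$ of resource types; for each $r\in R$ a finite set $S^r$ of starting locations and, for each $s\in S^r$, a number $l_s^r$ of resources of type $r$ starting at $s$; for each demand $d\in D$ a nonempty set $M_d\subseteq R$ of required resource types, a service start time $\tau_d\ge 0$, a service duration (service time) $\Delta_d>0$ and a reward $w_d\ge 0$; and travel times $f_{xy}\ge 0$ between any two locations ($f_{ij}$ is the travel time between the locations of demands $i$ and $j$, and $f_{sd}$ that from starting location $s$ to the location of demand $d$). All these numbers are integers, except that here service times are allowed to be infinite. Demand $d$ requires one unit of every resource type in $M_d$ simultaneously at time $\tau_d$ for duration $\Delta_d$. A resource of type $r$ starting at $s\in S^r$ can serve $d$ as its first demand iff $r\in M_d$ and $f_{sd}\le\tau_d$; a resource of type $r$ can serve $j$ immediately after $i$ iff $r\in M_i\cap M_j$ and $\tau_i+\Delta_i+f_{ij}\le\tau_j$ (so when $\Delta_i=\infty$ a resource serving $i$ can serve no further demand). A feasible solution assigns to each resource a (possibly empty) path, i.e. a sequence of demands whose first element can be served first and in which each consecutive pair can be served one immediately after the other. Demand $d$ is met if, for every $r\in M_d$, at least one resource of type $r$ has $d$ on its path. The objective is to maximize the sum of $w_d$ over met demands $d$. *)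

theory Defs
  imports Main "HOL-Library.Extended_Nat" "HOL-Library.Discrete_Functions"
    "HOL-Computational_Algebra.Polynomial"
begin

section \<open>Heterogeneous multi-resource allocation\<close>

datatype ('d, 's) location = Start 's | Site 'd

text \<open>\<open>capacity I r s\<close> is the number of resources of type \<open>r\<close> that start at \<open>s\<close>; it is
  meaningful only for \<open>s \<in> starts I r\<close>.  The sets \<open>starts I r\<close> may overlap for different \<open>r\<close>.\<close>

record ('d, 'r, 's) mrmd =
  demands :: "'d set"
  rtypes :: "'r set"
  starts :: "'r \<Rightarrow> 's set"
  capacity :: "'r \<Rightarrow> 's \<Rightarrow> nat"
  required :: "'d \<Rightarrow> 'r set"
  start_time :: "'d \<Rightarrow> nat"
  duration :: "'d \<Rightarrow> enat"
  reward :: "'d \<Rightarrow> nat"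
  travel :: "('d, 's) location \<Rightarrow> ('d, 's) location \<Rightarrow> nat"

definition all_starts :: "('d, 'r, 's) mrmd \<Rightarrow> 's set" where
  "all_starts I = (\<Union>r\<in>rtypes I. starts I r)"

definition locations :: "('d, 'r, 's) mrmd \<Rightarrow> ('d, 's) location set" where
  "locations I = Start ` all_starts I \<union> Site ` demands I"

definition mrmd_instance :: "('d, 'r, 's) mrmd \<Rightarrow> bool" where
  "mrmd_instance I \<longleftrightarrow>
     finite (demands I) \<and> finite (rtypes I) \<and> (\<forall>r\<in>rtypes I. finite (starts I r)) \<and>
     (\<forall>d\<in>demands I. required I d \<noteq> {} \<and> required I d \<subseteq> rtypes I \<and> duration I d > 0)"

text \<open>A resource is a triple of its type, its starting location, and its number among the
  resources with this type and starting location.\<close>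

type_synonym ('r, 's) resource = "'r \<times> 's \<times> nat"

definition resources :: "('d, 'r, 's) mrmd \<Rightarrow> ('r, 's) resource set" where
  "resources I = {(r, s, k). r \<in> rtypes I \<and> s \<in> starts I r \<and> k < capacity I r s}"

definition can_serve_first :: "('d, 'r, 's) mrmd \<Rightarrow> 'r \<Rightarrow> 's \<Rightarrow> 'd \<Rightarrow> bool" where
  "can_serve_first I r s d \<longleftrightarrow>
     r \<in> required I d \<and> travel I (Start s) (Site d) \<le> start_time I d"

definition can_serve_after :: "('d, 'r, 's) mrmd \<Rightarrow> 'r \<Rightarrow> 'd \<Rightarrow> 'd \<Rightarrow> bool" where
  "can_serve_after I r i j \<longleftrightarrow>
     r \<in> required I i \<inter> required I j \<and>
     enat (start_time I i) + duration I i + enat (travel I (Site i) (Site j)) \<le> enat (start_time I j)"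

fun feasible_path :: "('d, 'r, 's) mrmd \<Rightarrow> ('r, 's) resource \<Rightarrow> 'd list \<Rightarrow> bool" where
  "feasible_path I (r, s, k) ds \<longleftrightarrow>
     set ds \<subseteq> demands I \<and> (ds \<noteq> [] \<longrightarrow> can_serve_first I r s (hd ds)) \<and>
     successively (can_serve_after I r) ds"

definition feasible :: "('d, 'r, 's) mrmd \<Rightarrow> (('r, 's) resource \<Rightarrow> 'd list) \<Rightarrow> bool" where
  "feasible I P \<longleftrightarrow> (\<forall>\<rho>\<in>resources I. feasible_path I \<rho> (P \<rho>))"

definition met :: "('d, 'r, 's) mrmd \<Rightarrow> (('r, 's) resource \<Rightarrow> 'd list) \<Rightarrow> 'd set" where
  "met I P = {d \<in> demands I.
     \<forall>r\<in>required I d. \<exists>s k. (r, s, k) \<in> resources I \<and> d \<in> set (P (r, s, k))}"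

definition total_reward :: "('d, 'r, 's) mrmd \<Rightarrow> (('r, 's) resource \<Rightarrow> 'd list) \<Rightarrow> nat" where
  "total_reward I P = (\<Sum>d\<in>met I P. reward I d)"

definition optimal :: "('d, 'r, 's) mrmd \<Rightarrow> (('r, 's) resource \<Rightarrow> 'd list) \<Rightarrow> bool" where
  "optimal I P \<longleftrightarrow> feasible I P \<and> (\<forall>Q. feasible I Q \<longrightarrow> total_reward I Q \<le> total_reward I P)"


definition one_or_all :: "('d, 'r, 's) mrmd \<Rightarrow> bool" where
  "one_or_all I \<longleftrightarrow> (\<forall>d\<in>demands I. card (required I d) = 1 \<or> required I d = rtypes I)"

definition zero_travel_times :: "('d, 'r, 's) mrmd \<Rightarrow> bool" where
  "zero_travel_times I \<longleftrightarrow> (\<forall>x\<in>locations I. \<forall>y\<in>locations I. travel I x y = 0)"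

definition infinite_service_times :: "('d, 'r, 's) mrmd \<Rightarrow> bool" where
  "infinite_service_times I \<longleftrightarrow> (\<forall>d\<in>demands I. duration I d = \<infinity>)"

definition same_start_times :: "('d, 'r, 's) mrmd \<Rightarrow> bool" where
  "same_start_times I \<longleftrightarrow> (\<forall>i\<in>demands I. \<forall>j\<in>demands I. start_time I i = start_time I j)"


section \<open>Random access machines with logarithmic cost\<close>

text \<open>Programs are random access machine programs in structured form.  A state consists of
  registers, which are addressed directly, and of a memory, which is addressed indirectly through
  registers.  Every operation is charged the number of bits of its operands, including memory
  addresses (logarithmic cost), so that running times agree with those of Turing machines up to
  a polynomial.\<close>

datatype com =
    Skip
  | Const nat nat
  | Add nat nat nat
  | Sub nat nat nat
  | Load nat nat
  | Store nat nat
  | Seq com com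
  | If nat com com
  | While nat com

type_synonym state = "(nat \<Rightarrow> nat) \<times> (nat \<Rightarrow> nat)"

definition bit_length :: "nat \<Rightarrow> nat" where
  "bit_length n = Suc (floor_log n)"

text \<open>\<open>exec c \<sigma> t \<sigma>'\<close>: started in \<open>\<sigma>\<close>, the program \<open>c\<close> terminates in \<open>\<sigma>'\<close> at cost \<open>t\<close>.
  Subtraction is truncated at \<open>0\<close>; tests check whether a register is nonzero.\<close>

inductive exec :: "com \<Rightarrow> state \<Rightarrow> nat \<Rightarrow> state \<Rightarrow> bool" where
  Skip: "exec Skip \<sigma> 1 \<sigma>"
| Const: "exec (Const x n) (R, M) (bit_length n) (R(x := n), M)"
| Add: "exec (Add x y z) (R, M) (bit_length (R y) + bit_length (R z)) (R(x := R y + R z), M)"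
| Sub: "exec (Sub x y z) (R, M) (bit_length (R y) + bit_length (R z)) (R(x := R y - R z), M)"
| Load: "exec (Load x y) (R, M) (bit_length (R y) + bit_length (M (R y))) (R(x := M (R y)), M)"
| Store: "exec (Store x y) (R, M) (bit_length (R x) + bit_length (R y)) (R, M(R x := R y))"
| Seq: "exec c\<^sub>1 \<sigma> t\<^sub>1 \<sigma>' \<Longrightarrow> exec c\<^sub>2 \<sigma>' t\<^sub>2 \<sigma>'' \<Longrightarrow> exec (Seq c\<^sub>1 c\<^sub>2) \<sigma> (t\<^sub>1 + t\<^sub>2) \<sigma>''"
| IfTrue: "R x \<noteq> 0 \<Longrightarrow> exec c\<^sub>1 (R, M) t \<sigma> \<Longrightarrow> exec (If x c\<^sub>1 c\<^sub>2) (R, M) (bit_length (R x) + t) \<sigma>"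
| IfFalse: "R x = 0 \<Longrightarrow> exec c\<^sub>2 (R, M) t \<sigma> \<Longrightarrow> exec (If x c\<^sub>1 c\<^sub>2) (R, M) (bit_length (R x) + t) \<sigma>"
| WhileTrue: "R x \<noteq> 0 \<Longrightarrow> exec c (R, M) t\<^sub>1 \<sigma> \<Longrightarrow> exec (While x c) \<sigma> t\<^sub>2 \<sigma>' \<Longrightarrow>
    exec (While x c) (R, M) (bit_length (R x) + t\<^sub>1 + t\<^sub>2) \<sigma>'"
| WhileFalse: "R x = 0 \<Longrightarrow> exec (While x c) (R, M) (bit_length (R x)) (R, M)"

text \<open>The input is placed in the memory from address \<open>0\<close> on and its length in register \<open>0\<close>; the
  output is read off in the same way.\<close>

definition initial_state :: "nat list \<Rightarrow> state" where
  "initial_state xs =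
     ((\<lambda>x. if x = 0 then length xs else 0), (\<lambda>a. if a < length xs then xs ! a else 0))"

fun output_of :: "state \<Rightarrow> nat list" where
  "output_of (R, M) = map M [0..<R 0]"

definition bit_size :: "nat list \<Rightarrow> nat" where
  "bit_size xs = (\<Sum>x\<leftarrow>xs. bit_length x)"

text \<open>The set \<open>X\<close> contains the admissible instances, \<open>enc\<close> encodes them, and \<open>ans i ys\<close> means that
  \<open>ys\<close> encodes a correct answer for \<open>i\<close>.  The size of the output is bounded separately because
  the machine is not charged for untouched memory cells that belong to the output.\<close>

definition solvable_in_polynomial_time ::
    "'i set \<Rightarrow> ('i \<Rightarrow> nat list) \<Rightarrow> ('i \<Rightarrow> nat list \<Rightarrow> bool) \<Rightarrow> bool" where
  "solvable_in_polynomial_time X enc ans \<longleftrightarrow>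
     (\<exists>c. \<exists>p :: nat poly. \<forall>i\<in>X. \<exists>t \<sigma>.
        exec c (initial_state (enc i)) t \<sigma> \<and> ans i (output_of \<sigma>) \<and>
        t + bit_size (output_of \<sigma>) \<le> poly p (bit_size (enc i)))"


section \<open>Encoding of instances and solutions\<close>

text \<open>To be written down, demands, resource types and starting locations are numbered
  consecutively from \<open>0\<close>.\<close>

definition numbered :: "(nat, nat, nat) mrmd \<Rightarrow> bool" where
  "numbered I \<longleftrightarrow> (\<exists>n. demands I = {..<n}) \<and> (\<exists>m. rtypes I = {..<m}) \<and> (\<exists>q. all_starts I = {..<q})"

text \<open>Service durations are positive, so \<open>0\<close> is free to encode an infinite duration.\<close>

definition encode_duration :: "enat \<Rightarrow> nat" where
  "encode_duration \<Delta> = (case \<Delta> of enat t \<Rightarrow> t | \<infinity> \<Rightarrow> 0)"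

definition encode_instance :: "(nat, nat, nat) mrmd \<Rightarrow> nat list" where
  "encode_instance I =
     (let n = card (demands I); m = card (rtypes I); q = card (all_starts I);
          locs = map Start [0..<q] @ map Site [0..<n]
      in [n, m, q] @
         concat [if s \<in> starts I r then [1, capacity I r s] else [0, 0]. r \<leftarrow> [0..<m], s \<leftarrow> [0..<q]] @
         concat [[of_bool (r \<in> required I d). r \<leftarrow> [0..<m]] @
                 [start_time I d, encode_duration (duration I d), reward I d]. d \<leftarrow> [0..<n]] @
         [travel I x y. x \<leftarrow> locs, y \<leftarrow> locs])"

text \<open>A solution is written down as a list of resources together with their paths; all resources
  that are not listed have the empty path.  (The number of resources can be exponential in the
  size of the instance.)\<close>

type_synonym plan_list = "((nat, nat) resource \<times> nat list) list"

definition paths_of :: "plan_list \<Rightarrow> (nat, nat) resource \<Rightarrow> nat list" where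
  "paths_of es \<rho> = (case map_of es \<rho> of None \<Rightarrow> [] | Some ds \<Rightarrow> ds)"

definition encode_plan :: "plan_list \<Rightarrow> nat list" where
  "encode_plan es = length es # concat [[r, s, k, length ds] @ ds. ((r, s, k), ds) \<leftarrow> es]"

definition encodes_optimal_solution :: "(nat, nat, nat) mrmd \<Rightarrow> nat list \<Rightarrow> bool" where
  "encodes_optimal_solution I ys \<longleftrightarrow>
     (\<exists>es. ys = encode_plan es \<and> distinct (map fst es) \<and> fst ` set es \<subseteq> resources I \<and>
           optimal I (paths_of es))"

end

theory Submission
  imports Defs
begin

text \<open>
  Since service times are infinite, every resource serves at most one demand, and since travel times
  vanish, only the total supply of each resource type matters.  Fix the number \<open>k\<close> of met demands
  that require all types.  What remains are independent cardinality constraints, one for the demands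
  that require all types and one for each type, so it is optimal to take the most rewarding demands
  of each group.  Trying all \<open>k\<close> gives an optimal solution.

  No arrays are needed: the rank of a demand in its group, the supplies, the value of a threshold
  \<open>k\<close> and the resource assigned to a demand are nested sums over the input.  They are
  written in a small expression language whose sums all range over the addresses of the input and
  which is compiled to random access machines.  Without multiplication, one step increases the
  largest bit length by at most one, so a polynomial number of steps has polynomial logarithmic
  cost.
\<close>

section \<open>Unit cost\<close>

text \<open>Fixing \<open>k\<close> decouples the types: if \<open>k\<close> demands that require
  all types are met, type \<open>r\<close> keeps \<open>stock r - k\<close> resources, and demands
  with different single types no longer compete. For the upper bound, \<open>k\<close> is read off
  from an arbitrary solution as the number of such demands that it meets, so it is at most the
  number of demands. Conversely, every \<open>k\<close>, even one above some supply, yields a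
  feasible plan, so no threshold promises a value that cannot be attained. The number of resources
  can be exponential in the input size, so no loop may run over them. Prefix sums of capacities
  locate the starting location that contains a given position, and the resource number is the
  remainder. On the machine side, a step is charged for at most two operands, each of at most
  \<open>b + s + 1\<close> bits after \<open>s\<close> steps; this is the shape of the bound
  \<open>2 * s * (b + s + 1)\<close>. Expressions are re-evaluated from the input all the time, so
  the input has to survive until the end: the output is written behind it and moved to address 0
  last.\<close>

definition bounded_state :: "nat \<Rightarrow> state \<Rightarrow> bool" where
  "bounded_state b \<sigma> \<longleftrightarrow> (\<forall>x. fst \<sigma> x < 2 ^ b \<and> snd \<sigma> x < 2 ^ b)"

text \<open>Here \<open>s\<close> is a number of unit cost steps; it also bounds the growth of the bit lengths.\<close>

definition reach :: "com \<Rightarrow> state \<Rightarrow> nat \<Rightarrow> state \<Rightarrow> bool" where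
  "reach c \<sigma> s \<sigma>' \<longleftrightarrow> (\<forall>b. bounded_state b \<sigma> \<longrightarrow>
     bounded_state (b + s) \<sigma>' \<and> (\<exists>t \<le> 2 * s * (b + s + 1). exec c \<sigma> t \<sigma>'))"

text \<open>The extra 1 is slack for positive \<open>b\<close>, but it is needed for
  \<open>b = 0\<close>, since the number 0 has bit length 1.\<close>

lemma bit_length_le: "v < 2 ^ b \<Longrightarrow> bit_length v \<le> b + 1"
proof -
  assume v: "v < 2 ^ b"
  have "floor_log v \<le> floor_log (2 ^ b)" using v by (intro floor_log_le_iff) simp
  then show ?thesis by (simp add: bit_length_def)
qed

lemma bit_length_bounded_state:
  assumes "bounded_state b (R, M)"
  shows "bit_length (R x) \<le> b + 1" "bit_length (M x) \<le> b + 1"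
  using assms by (auto simp only: bounded_state_def fst_conv snd_conv intro!: bit_length_le)

lemma less_two_power_bit_length: "v < 2 ^ bit_length v"
  using floor_log_exp2_gt[of v] by (cases "v = 0") (auto simp: bit_length_def)

lemma bounded_state_mono: "bounded_state b \<sigma> \<Longrightarrow> b \<le> b' \<Longrightarrow> bounded_state b' \<sigma>"
  unfolding bounded_state_def by (meson less_le_trans one_le_numeral power_increasing)

lemma reach_mono: "reach c \<sigma> s \<sigma>' \<Longrightarrow> s \<le> s' \<Longrightarrow> reach c \<sigma> s' \<sigma>'"
  unfolding reach_def
proof (intro allI impI)
  fix b
  assume *: "\<forall>b. bounded_state b \<sigma> \<longrightarrow>
     bounded_state (b + s) \<sigma>' \<and> (\<exists>t \<le> 2 * s * (b + s + 1). exec c \<sigma> t \<sigma>')"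
    and le: "s \<le> s'" and b: "bounded_state b \<sigma>"
  from * b obtain t where t: "t \<le> 2 * s * (b + s + 1)" "exec c \<sigma> t \<sigma>'" by blast
  have "2 * s * (b + s + 1) \<le> 2 * s' * (b + s' + 1)" using le by (intro mult_le_mono) auto
  with t have "\<exists>t \<le> 2 * s' * (b + s' + 1). exec c \<sigma> t \<sigma>'" by (meson le_trans)
  moreover have "bounded_state (b + s') \<sigma>'"
    using * b le bounded_state_mono by (meson add_left_mono)
  ultimately show "bounded_state (b + s') \<sigma>' \<and> (\<exists>t \<le> 2 * s' * (b + s' + 1). exec c \<sigma> t \<sigma>')"
    by blast
qed

text \<open>Covers all atomic instructions. The successor form serves both unit steps
  (\<open>s = 0\<close>) and constants, which count as \<open>n + 1\<close> steps; the factor 2 pays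
  for two operands.\<close>

lemma reach_single:
  assumes "\<And>b. bounded_state b \<sigma> \<Longrightarrow> bounded_state (b + Suc s) \<sigma>'"
    and "exec c \<sigma> t \<sigma>'" and "\<And>b. bounded_state b \<sigma> \<Longrightarrow> t \<le> 2 * (b + Suc s + 1)"
  shows "reach c \<sigma> (Suc s) \<sigma>'"
  unfolding reach_def
proof (intro allI impI conjI)
  fix b assume b: "bounded_state b \<sigma>"
  have "t \<le> 2 * (b + Suc s + 1)" using assms(3)[OF b] .
  also have "\<dots> \<le> 2 * Suc s * (b + Suc s + 1)" by simp
  finally show "\<exists>t\<le>2 * Suc s * (b + Suc s + 1). exec c \<sigma> t \<sigma>'" using assms(2) by blast
qed (rule assms(1))

lemma reach_Skip: "reach Skip \<sigma> 1 \<sigma>"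
  unfolding One_nat_def
proof (rule reach_single)
  fix b assume "bounded_state b \<sigma>"
  then show "bounded_state (b + Suc 0) \<sigma>" by (rule bounded_state_mono) simp
qed (rule exec.Skip, simp)

text \<open>Loading the constant \<open>n\<close> is counted as \<open>n + 1\<close> steps, so that here, too, the bit lengths
  grow by at most one per step.\<close>

lemma reach_Const: "reach (Const x n) (R, M) (Suc n) (R(x := n), M)"
proof (rule reach_single)
  fix b assume b: "bounded_state b (R, M)"
  have n: "n < 2 ^ n" by simp
  have "bit_length n \<le> n + 1" by (rule bit_length_le[OF n])
  then show "bit_length n \<le> 2 * (b + Suc n + 1)" by simp
  have "(2::nat) ^ b \<le> 2 ^ (b + Suc n)" "(2::nat) ^ n \<le> 2 ^ (b + Suc n)"
    by (intro power_increasing; simp)+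
  then show "bounded_state (b + Suc n) (R(x := n), M)"
    using b less_le_trans[OF n] bounded_state_mono[OF b, of "b + Suc n"]
    by (auto simp: bounded_state_def simp del: power_Suc add_Suc_right)
qed (rule exec.Const)

lemma reach_Add: "reach (Add x y z) (R, M) 1 (R(x := R y + R z), M)"
  unfolding One_nat_def
proof (rule reach_single)
  fix b assume b: "bounded_state b (R, M)"
  from bit_length_bounded_state[OF b] have "bit_length (R y) \<le> b + 1" "bit_length (R z) \<le> b + 1"
    by blast+
  then show "bit_length (R y) + bit_length (R z) \<le> 2 * (b + Suc 0 + 1)" by simp
  have "R y < 2 ^ b" "R z < 2 ^ b" using b by (auto simp: bounded_state_def)
  then have "R y + R z < 2 ^ (b + Suc 0)" by simp
  then show "bounded_state (b + Suc 0) (R(x := R y + R z), M)"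
    using bounded_state_mono[OF b, of "b + Suc 0"] by (simp add: bounded_state_def)
qed (rule exec.Add)

lemma reach_Sub: "reach (Sub x y z) (R, M) 1 (R(x := R y - R z), M)"
  unfolding One_nat_def
proof (rule reach_single)
  fix b assume b: "bounded_state b (R, M)"
  from bit_length_bounded_state[OF b] have "bit_length (R y) \<le> b + 1" "bit_length (R z) \<le> b + 1"
    by blast+
  then show "bit_length (R y) + bit_length (R z) \<le> 2 * (b + Suc 0 + 1)" by simp
  have "bounded_state b (R(x := R y - R z), M)"
    using b by (auto simp: bounded_state_def intro: le_less_trans[OF diff_le_self])
  then show "bounded_state (b + Suc 0) (R(x := R y - R z), M)"
    by (rule bounded_state_mono) simp
qed (rule exec.Sub)

lemma reach_Load: "reach (Load x y) (R, M) 1 (R(x := M (R y)), M)"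
  unfolding One_nat_def
proof (rule reach_single)
  fix b assume b: "bounded_state b (R, M)"
  from bit_length_bounded_state[OF b] have "bit_length (R y) \<le> b + 1" "bit_length (M (R y)) \<le> b + 1"
    by blast+
  then show "bit_length (R y) + bit_length (M (R y)) \<le> 2 * (b + Suc 0 + 1)" by simp
  have "bounded_state b (R(x := M (R y)), M)" using b by (auto simp: bounded_state_def)
  then show "bounded_state (b + Suc 0) (R(x := M (R y)), M)"
    by (rule bounded_state_mono) simp
qed (rule exec.Load)

lemma reach_Store: "reach (Store x y) (R, M) 1 (R, M(R x := R y))"
  unfolding One_nat_def
proof (rule reach_single)
  fix b assume b: "bounded_state b (R, M)"
  from bit_length_bounded_state[OF b] have "bit_length (R x) \<le> b + 1" "bit_length (R y) \<le> b + 1"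
    by blast+
  then show "bit_length (R x) + bit_length (R y) \<le> 2 * (b + Suc 0 + 1)" by simp
  have "bounded_state b (R, M(R x := R y))" using b by (auto simp: bounded_state_def)
  then show "bounded_state (b + Suc 0) (R, M(R x := R y))"
    by (rule bounded_state_mono) simp
qed (rule exec.Store)

text \<open>Composition works because \<open>reach\<close> quantifies over all \<open>b\<close>: the
  second program is used at the bit bound \<open>b + s1\<close> that the first one leaves
  behind.\<close>

lemma reach_Seq:
  assumes "reach c1 \<sigma> s1 \<sigma>'" "reach c2 \<sigma>' s2 \<sigma>''"
  shows "reach (Seq c1 c2) \<sigma> (s1 + s2) \<sigma>''"
  unfolding reach_def
proof (intro allI impI)
  fix b assume b: "bounded_state b \<sigma>"
  obtain t1 where 1: "t1 \<le> 2 * s1 * (b + s1 + 1)" "exec c1 \<sigma> t1 \<sigma>'" "bounded_state (b + s1) \<sigma>'"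
    using assms(1) b unfolding reach_def by blast
  obtain t2 where 2: "t2 \<le> 2 * s2 * (b + s1 + s2 + 1)" "exec c2 \<sigma>' t2 \<sigma>''"
      "bounded_state (b + s1 + s2) \<sigma>''"
    using assms(2) 1(3) unfolding reach_def by blast
  have "t1 + t2 \<le> 2 * (s1 + s2) * (b + (s1 + s2) + 1)"
    using 1(1) 2(1) by (simp add: algebra_simps)
  with 1 2 show "bounded_state (b + (s1 + s2)) \<sigma>'' \<and>
      (\<exists>t\<le>2 * (s1 + s2) * (b + (s1 + s2) + 1). exec (Seq c1 c2) \<sigma> t \<sigma>'')"
    using exec.Seq[OF 1(2) 2(2)] by (auto simp: add.assoc)
qed

text \<open>One additional step pays for testing a register; this is shared by both branches of a
  conditional and by loops.\<close>

lemma reach_add_test: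
  assumes "reach c \<sigma>1 s \<sigma>'" "bounded_state b \<sigma>1" "fst \<sigma>1 x < 2 ^ b"
  obtains t where "bit_length (fst \<sigma>1 x) + t \<le> 2 * (s + 1) * (b + (s + 1) + 1)"
    "exec c \<sigma>1 t \<sigma>'" "bounded_state (b + (s + 1)) \<sigma>'"
proof -
  obtain t where t: "t \<le> 2 * s * (b + s + 1)" "exec c \<sigma>1 t \<sigma>'" "bounded_state (b + s) \<sigma>'"
    using assms(1,2) unfolding reach_def by blast
  have "bit_length (fst \<sigma>1 x) \<le> b + 1" using bit_length_le[OF assms(3)] .
  then have "bit_length (fst \<sigma>1 x) + t \<le> 2 * (s + 1) * (b + (s + 1) + 1)"
    using t(1) by (simp add: algebra_simps)
  then show ?thesis using that t(2) bounded_state_mono[OF t(3)] by simp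
qed

lemma reach_IfTrue:
  assumes "R x \<noteq> 0" "reach c1 (R, M) s \<sigma>'"
  shows "reach (If x c1 c2) (R, M) (s + 1) \<sigma>'"
  unfolding reach_def
proof (intro allI impI)
  fix b assume b: "bounded_state b (R, M)"
  obtain t where "bit_length (R x) + t \<le> 2 * (s + 1) * (b + (s + 1) + 1)"
    "exec c1 (R, M) t \<sigma>'" "bounded_state (b + (s + 1)) \<sigma>'"
    using reach_add_test[OF assms(2) b, of x] b by (auto simp: bounded_state_def)
  then show "bounded_state (b + (s + 1)) \<sigma>' \<and>
      (\<exists>t\<le>2 * (s + 1) * (b + (s + 1) + 1). exec (If x c1 c2) (R, M) t \<sigma>')"
    using exec.IfTrue[where R = R and x = x, OF assms(1)] by blast
qed

lemma reach_IfFalse: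
  assumes "R x = 0" "reach c2 (R, M) s \<sigma>'"
  shows "reach (If x c1 c2) (R, M) (s + 1) \<sigma>'"
  unfolding reach_def
proof (intro allI impI)
  fix b assume b: "bounded_state b (R, M)"
  obtain t where "bit_length (R x) + t \<le> 2 * (s + 1) * (b + (s + 1) + 1)"
    "exec c2 (R, M) t \<sigma>'" "bounded_state (b + (s + 1)) \<sigma>'"
    using reach_add_test[OF assms(2) b, of x] b by (auto simp: bounded_state_def)
  then show "bounded_state (b + (s + 1)) \<sigma>' \<and>
      (\<exists>t\<le>2 * (s + 1) * (b + (s + 1) + 1). exec (If x c1 c2) (R, M) t \<sigma>')"
    using exec.IfFalse[where R = R and x = x, OF assms(1)] by blast
qed

lemma reach_WhileFalse:
  assumes "R x = 0"
  shows "reach (While x c) (R, M) 1 (R, M)"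
  unfolding One_nat_def
proof (rule reach_single)
  fix b assume b: "bounded_state b (R, M)"
  then show "bounded_state (b + Suc 0) (R, M)" by (rule bounded_state_mono) simp
  show "bit_length (R x) \<le> 2 * (b + Suc 0 + 1)"
    using assms by (simp add: bit_length_def)
qed (rule exec.WhileFalse[where R = R and x = x, OF assms])

lemma reach_WhileTrue:
  assumes x: "R x \<noteq> 0" and c: "reach c (R, M) s1 \<sigma>'" and w: "reach (While x c) \<sigma>' s2 \<sigma>''"
  shows "reach (While x c) (R, M) (s1 + 1 + s2) \<sigma>''"
  unfolding reach_def
proof (intro allI impI)
  fix b assume b: "bounded_state b (R, M)"
  obtain t1 where 1: "bit_length (R x) + t1 \<le> 2 * (s1 + 1) * (b + (s1 + 1) + 1)"
    "exec c (R, M) t1 \<sigma>'" "bounded_state (b + (s1 + 1)) \<sigma>'"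
    using reach_add_test[OF c b, of x] b by (auto simp: bounded_state_def)
  obtain t2 where 2: "t2 \<le> 2 * s2 * (b + (s1 + 1) + s2 + 1)" "exec (While x c) \<sigma>' t2 \<sigma>''"
      "bounded_state (b + (s1 + 1) + s2) \<sigma>''"
    using w 1(3) unfolding reach_def by blast
  have "exec (While x c) (R, M) (bit_length (R x) + t1 + t2) \<sigma>''"
    using exec.WhileTrue[where R = R and x = x, OF x 1(2) 2(2)] .
  moreover have "bit_length (R x) + t1 + t2 \<le> 2 * (s1 + 1 + s2) * (b + (s1 + 1 + s2) + 1)"
    using 1(1) 2(1) by (simp add: algebra_simps)
  moreover have "bounded_state (b + (s1 + 1 + s2)) \<sigma>''" using 2(3) by (simp add: add.assoc)
  ultimately show "bounded_state (b + (s1 + 1 + s2)) \<sigma>'' \<and>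
      (\<exists>t\<le>2 * (s1 + 1 + s2) * (b + (s1 + 1 + s2) + 1). exec (While x c) (R, M) t \<sigma>'')"
    by blast
qed

text \<open>Rule for loops with a known number \<open>n\<close> of iterations and one step bound
  \<open>s\<close> for each of them. The index of \<open>P\<close> counts completed iterations, so
  no separate termination measure is needed.\<close>

lemma reach_While:
  assumes step: "\<And>i R M. i < n \<Longrightarrow> P i R M \<Longrightarrow>
      R x \<noteq> 0 \<and> (\<exists>R' M'. reach c (R, M) s (R', M') \<and> P (Suc i) R' M')"
    and stop: "\<And>R M. P n R M \<Longrightarrow> R x = 0"
    and start: "P 0 R M"
  shows "\<exists>R' M'. reach (While x c) (R, M) (n * (s + 1) + 1) (R', M') \<and> P n R' M'"
proof -
  have "i \<le> n \<Longrightarrow> P i R M \<Longrightarrow>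
      \<exists>R' M'. reach (While x c) (R, M) ((n - i) * (s + 1) + 1) (R', M') \<and> P n R' M'" for i R M
  proof (induction "n - i" arbitrary: i R M)
    case 0
    then have "i = n" by simp
    with 0 have "P n R M" by simp
    moreover have "reach (While x c) (R, M) ((n - i) * (s + 1) + 1) (R, M)"
      using reach_WhileFalse[where R = R and x = x, OF stop[OF \<open>P n R M\<close>]] by (simp add: \<open>i = n\<close>)
    ultimately show ?case by blast
  next
    case (Suc j)
    then have "i < n" by simp
    with step[OF this Suc.prems(2)] obtain R1 M1 where 1: "R x \<noteq> 0"
      "reach c (R, M) s (R1, M1)" "P (Suc i) R1 M1" by blast
    obtain R' M' where 2: "reach (While x c) (R1, M1) ((n - Suc i) * (s + 1) + 1) (R', M')"
      "P n R' M'"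
    proof -
      have "j = n - Suc i" "Suc i \<le> n" using Suc.hyps(2) \<open>i < n\<close> by auto
      from Suc.hyps(1)[OF this 1(3)] that show thesis by blast
    qed
    have "n - i = Suc (n - Suc i)" using \<open>i < n\<close> by simp
    then have "s + 1 + ((n - Suc i) * (s + 1) + 1) = (n - i) * (s + 1) + 1" by simp
    with reach_WhileTrue[where R = R and x = x, OF 1(1,2) 2(1)] 2(2) show ?case by auto
  qed
  from this[of 0 R M] start show ?thesis by simp
qed

section \<open>Compiling expressions\<close>

text \<open>The machine has no register copy: the target is cleared and the source is added, which
  is why target and source must differ.\<close>

definition Move :: "nat \<Rightarrow> nat \<Rightarrow> com" where
  "Move x y = Seq (Const x 0) (Add x x y)"

lemma reach_Move: "x \<noteq> y \<Longrightarrow> reach (Move x y) (R, M) 2 (R(x := R y), M)"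
  using reach_Seq[OF reach_Const[of x 0 R M] reach_Add[of x x y "R(x := 0)" M]]
  by (simp add: Move_def numeral_2_eq_2)

datatype exp =
    Num nat
  | Var nat
  | Plus exp exp
  | Minus exp exp
  | Fetch exp
  | Cond exp exp exp
  | SumBelow nat exp

text \<open>All sums and loops range over the addresses of the input, so polynomial running time is
  automatic.\<close>

primrec eval :: "nat list \<Rightarrow> (nat \<Rightarrow> nat) \<Rightarrow> exp \<Rightarrow> nat" where
  "eval xs R (Num n) = n"
| "eval xs R (Var x) = R x"
| "eval xs R (Plus a b) = eval xs R a + eval xs R b"
| "eval xs R (Minus a b) = eval xs R a - eval xs R b"
| "eval xs R (Fetch a) = (if eval xs R a < length xs then xs ! eval xs R a else 0)"
| "eval xs R (Cond a b c) = (if eval xs R a \<noteq> 0 then eval xs R b else eval xs R c)"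
| "eval xs R (SumBelow x a) = (\<Sum>v<length xs. eval xs (R(x := v)) a)"

text \<open>Variables are registers.  Register \<open>0\<close> holds the length of the input, register \<open>1\<close> is
  the output pointer, and registers from \<open>k\<close> on are free for intermediate results.\<close>

primrec wf_exp :: "exp \<Rightarrow> nat \<Rightarrow> bool" where
  "wf_exp (Num n) k \<longleftrightarrow> True"
| "wf_exp (Var x) k \<longleftrightarrow> 2 \<le> x \<and> x < k"
| "wf_exp (Plus a b) k \<longleftrightarrow> wf_exp a k \<and> wf_exp b k"
| "wf_exp (Minus a b) k \<longleftrightarrow> wf_exp a k \<and> wf_exp b k"
| "wf_exp (Fetch a) k \<longleftrightarrow> wf_exp a k"
| "wf_exp (Cond a b c) k \<longleftrightarrow> wf_exp a k \<and> wf_exp b k \<and> wf_exp c k"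
| "wf_exp (SumBelow x a) k \<longleftrightarrow> 2 \<le> x \<and> x < k \<and> wf_exp a k"

text \<open>The result goes to register \<open>k\<close>, registers below \<open>k\<close> are
  restored, and larger ones are scratch. \<open>Fetch\<close> compares the address with register 0
  before loading, since cells behind the input may already hold output. \<open>SumBelow\<close>
  saves the old value of \<open>x\<close> in \<open>k + 1\<close>, and \<open>k + 2\<close> counts
  the remaining iterations because loops can only test for nonzero.\<close>

primrec compile :: "exp \<Rightarrow> nat \<Rightarrow> com" where
  "compile (Num n) k = Const k n"
| "compile (Var x) k = Move k x"
| "compile (Plus a b) k = Seq (compile a k) (Seq (compile b (k + 1)) (Add k k (k + 1)))"
| "compile (Minus a b) k = Seq (compile a k) (Seq (compile b (k + 1)) (Sub k k (k + 1)))"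
| "compile (Fetch a) k =
     Seq (compile a k) (Seq (Sub (k + 1) 0 k) (If (k + 1) (Load k k) (Const k 0)))"
| "compile (Cond a b c) k = Seq (compile a k) (If k (compile b k) (compile c k))"
| "compile (SumBelow x a) k =
     Seq (Const k 0) (Seq (Move (k + 1) x) (Seq (Const x 0) (Seq (Move (k + 2) 0)
       (Seq (While (k + 2)
         (Seq (compile a (k + 3)) (Seq (Add k k (k + 3)) (Seq (Const (k + 3) 1)
           (Seq (Add x x (k + 3)) (Sub (k + 2) 0 x))))))
         (Move x (k + 1))))))"

text \<open>The indeterminate is the input length. In the last case, 9 is set-up (6), final loop
  test (1) and restoring \<open>x\<close> (2); 6 is the test plus the five steps after evaluating
  the summand, where loading the constant 1 counts twice.\<close>

primrec exp_cost :: "exp \<Rightarrow> nat poly" where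
  "exp_cost (Num n) = [:Suc n:]"
| "exp_cost (Var x) = [:2:]"
| "exp_cost (Plus a b) = exp_cost a + exp_cost b + 1"
| "exp_cost (Minus a b) = exp_cost a + exp_cost b + 1"
| "exp_cost (Fetch a) = exp_cost a + [:3:]"
| "exp_cost (Cond a b c) = exp_cost a + exp_cost b + exp_cost c + 1"
| "exp_cost (SumBelow x a) = [:9:] + [:0, 1:] * (exp_cost a + [:6:])"

text \<open>Cells behind the input stay unconstrained, so that emitting output preserves the
  property.\<close>

definition holds_input :: "nat list \<Rightarrow> (nat \<Rightarrow> nat) \<Rightarrow> (nat \<Rightarrow> nat) \<Rightarrow> bool" where
  "holds_input xs R M \<longleftrightarrow> R 0 = length xs \<and> (\<forall>a<length xs. M a = xs ! a)"

lemma wf_exp_mono: "wf_exp e k \<Longrightarrow> k \<le> k' \<Longrightarrow> wf_exp e k'"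
  by (induction e) auto

text \<open>A well-formed expression reads as variables only registers from 2 up to
  \<open>k - 1\<close>; scratch registers and the output pointer may therefore change between
  evaluations.\<close>

lemma eval_cong:
  "wf_exp e k \<Longrightarrow> \<forall>y. 2 \<le> y \<longrightarrow> y < k \<longrightarrow> R y = R' y \<Longrightarrow> eval xs R e = eval xs R' e"
proof (induction e arbitrary: R R')
  case (SumBelow x a)
  have "eval xs (R(x := v)) a = eval xs (R'(x := v)) a" for v
    by (rule SumBelow.IH) (use SumBelow.prems in auto)
  then show ?case by simp
next
  case (Plus a b)
  from Plus.IH(1)[of R R'] Plus.IH(2)[of R R'] Plus.prems show ?case by simp
next
  case (Minus a b)
  from Minus.IH(1)[of R R'] Minus.IH(2)[of R R'] Minus.prems show ?case by simp
next
  case (Fetch a)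
  from Fetch.IH(1)[of R R'] Fetch.prems show ?case by simp
next
  case (Cond a b c)
  from Cond.IH(1)[of R R'] Cond.IH(2)[of R R'] Cond.IH(3)[of R R'] Cond.prems show ?case by simp
qed auto

lemma compiled:
  assumes "reach c (R, M) s (R', M)" "s \<le> s'" "R' k = v" "\<And>y. y < k \<Longrightarrow> R' y = R y"
  shows "\<exists>R'. reach c (R, M) s' (R', M) \<and> R' k = v \<and> (\<forall>y<k. R' y = R y)"
  using assms reach_mono by blast

lemma compile_correct:
  assumes "wf_exp e k" "2 \<le> k" "holds_input xs R M"
  shows "\<exists>R'. reach (compile e k) (R, M) (poly (exp_cost e) (length xs)) (R', M) \<and>
    R' k = eval xs R e \<and> (\<forall>y<k. R' y = R y)"
  using assms
proof (induction e arbitrary: k R)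
  case (Num n)
  show ?case
    unfolding compile.simps by (rule compiled[OF reach_Const]) simp_all
next
  case (Var x)
  then have "k \<noteq> x" by simp
  then show ?case
    unfolding compile.simps by (rule compiled[OF reach_Move]) simp_all
next
  case (Plus a b)
  obtain R1 where 1: "reach (compile a k) (R, M) (poly (exp_cost a) (length xs)) (R1, M)"
    "R1 k = eval xs R a" "\<forall>y<k. R1 y = R y"
    using Plus.IH(1)[of k R] Plus.prems by auto
  obtain R2 where 2: "reach (compile b (k + 1)) (R1, M) (poly (exp_cost b) (length xs)) (R2, M)"
    "R2 (k + 1) = eval xs R1 b" "\<forall>y<k + 1. R2 y = R1 y"
    using Plus.IH(2)[of "k + 1" R1] Plus.prems 1(3) wf_exp_mono[of b k "k + 1"]
    by (auto simp: holds_input_def)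
  have eq: "eval xs R1 b = eval xs R b"
    using eval_cong[of b k R1 R] 1(3) Plus.prems by auto
  show ?case
    unfolding compile.simps
    by (rule compiled[OF reach_Seq[OF 1(1) reach_Seq[OF 2(1) reach_Add]]]) (use 1 2 eq in simp_all)
next
  case (Minus a b)
  obtain R1 where 1: "reach (compile a k) (R, M) (poly (exp_cost a) (length xs)) (R1, M)"
    "R1 k = eval xs R a" "\<forall>y<k. R1 y = R y"
    using Minus.IH(1)[of k R] Minus.prems by auto
  obtain R2 where 2: "reach (compile b (k + 1)) (R1, M) (poly (exp_cost b) (length xs)) (R2, M)"
    "R2 (k + 1) = eval xs R1 b" "\<forall>y<k + 1. R2 y = R1 y"
    using Minus.IH(2)[of "k + 1" R1] Minus.prems 1(3) wf_exp_mono[of b k "k + 1"]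
    by (auto simp: holds_input_def)
  have eq: "eval xs R1 b = eval xs R b"
    using eval_cong[of b k R1 R] 1(3) Minus.prems by auto
  show ?case
    unfolding compile.simps
    by (rule compiled[OF reach_Seq[OF 1(1) reach_Seq[OF 2(1) reach_Sub]]]) (use 1 2 eq in simp_all)
next
  case (Fetch a)
  obtain R1 where 1: "reach (compile a k) (R, M) (poly (exp_cost a) (length xs)) (R1, M)"
    "R1 k = eval xs R a" "\<forall>y<k. R1 y = R y"
    using Fetch.IH(1)[of k R] Fetch.prems by auto
  define R2 where "R2 = R1(k + 1 := R1 0 - R1 k)"
  have len: "R1 0 = length xs" using 1(3) Fetch.prems by (auto simp: holds_input_def)
  have "reach (If (k + 1) (Load k k) (Const k 0)) (R2, M) 2 (R2(k := eval xs R (Fetch a)), M)"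
  proof (cases "R1 k < length xs")
    case True
    have "reach (If (k + 1) (Load k k) (Const k 0)) (R2, M) (1 + 1) (R2(k := M (R2 k)), M)"
      by (rule reach_IfTrue[OF _ reach_Load]) (use True len in \<open>simp add: R2_def\<close>)
    moreover have "M (R2 k) = eval xs R (Fetch a)"
      using True 1(2) Fetch.prems by (auto simp: R2_def holds_input_def)
    ultimately show ?thesis by (simp add: numeral_2_eq_2)
  next
    case False
    have "reach (If (k + 1) (Load k k) (Const k 0)) (R2, M) (Suc 0 + 1) (R2(k := 0), M)"
      by (rule reach_IfFalse[OF _ reach_Const]) (use False len in \<open>simp add: R2_def\<close>)
    moreover have "0 = eval xs R (Fetch a)"
      using False 1(2) by auto
    ultimately show ?thesis by (simp add: numeral_2_eq_2)
  qed
  note run = reach_Seq[OF 1(1) reach_Seq[OF reach_Sub[of "k + 1" 0 k] this[unfolded R2_def]]]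
  show ?case
    unfolding compile.simps by (rule compiled[OF run]) (use 1(3) in simp_all)
next
  case (Cond a b c)
  obtain R1 where 1: "reach (compile a k) (R, M) (poly (exp_cost a) (length xs)) (R1, M)"
    "R1 k = eval xs R a" "\<forall>y<k. R1 y = R y"
    using Cond.IH(1)[of k R] Cond.prems by auto
  have inp: "holds_input xs R1 M" using 1(3) Cond.prems by (auto simp: holds_input_def)
  show ?case
  proof (cases "R1 k = 0")
    case True
    obtain R2 where 2: "reach (compile c k) (R1, M) (poly (exp_cost c) (length xs)) (R2, M)"
      "R2 k = eval xs R1 c" "\<forall>y<k. R2 y = R1 y"
      using Cond.IH(3)[of k R1] Cond.prems inp by auto
    have eq: "eval xs R1 c = eval xs R c"
      using eval_cong[of c k R1 R] 1(3) Cond.prems by auto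
    note run = reach_Seq[OF 1(1) reach_IfFalse[where R = R1 and x = k, OF True 2(1)]]
    show ?thesis
      unfolding compile.simps by (rule compiled[OF run]) (use True 1 2 eq in simp_all)
  next
    case False
    obtain R2 where 2: "reach (compile b k) (R1, M) (poly (exp_cost b) (length xs)) (R2, M)"
      "R2 k = eval xs R1 b" "\<forall>y<k. R2 y = R1 y"
      using Cond.IH(2)[of k R1] Cond.prems inp by auto
    have eq: "eval xs R1 b = eval xs R b"
      using eval_cong[of b k R1 R] 1(3) Cond.prems by auto
    note run = reach_Seq[OF 1(1) reach_IfTrue[where R = R1 and x = k, OF False 2(1)]]
    show ?thesis
      unfolding compile.simps by (rule compiled[OF run]) (use False 1 2 eq in simp_all)
  qed
next
  case (SumBelow x a)
  have x: "2 \<le> x" "x < k" and wf: "wf_exp a k" using SumBelow.prems by auto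
  have R0: "R 0 = length xs" and M: "\<forall>a<length xs. M a = xs ! a"
    using SumBelow.prems by (auto simp: holds_input_def)
  define S where "S = R(k := 0, k + 1 := R x, x := 0, k + 2 := length xs)"
  have init: "reach (Seq (Const k 0) (Seq (Move (k + 1) x) (Seq (Const x 0) (Seq (Move (k + 2) 0) c))))
      (R, M) (Suc 0 + (2 + (Suc 0 + (2 + s)))) \<sigma>" if "reach c (S, M) s \<sigma>" for c s \<sigma>
    by (rule reach_Seq[OF reach_Const reach_Seq[OF reach_Move reach_Seq[OF reach_Const
      reach_Seq[OF reach_Move]]]]) (use that x R0 in \<open>simp_all add: S_def\<close>)
  \<comment> \<open>Register \<open>x\<close> is exempt from preservation during the loop and is
    restored from \<open>k + 1\<close> by the final move.\<close>
  define P where "P i R1 M1 \<longleftrightarrow> M1 = M \<and> R1 k = (\<Sum>v<i. eval xs (R(x := v)) a) \<and> R1 x = i \<and>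
    R1 (k + 1) = R x \<and> R1 (k + 2) = length xs - i \<and> (\<forall>y<k. y \<noteq> x \<longrightarrow> R1 y = R y)" for i R1 M1
  define body where "body = Seq (compile a (k + 3)) (Seq (Add k k (k + 3)) (Seq (Const (k + 3) 1)
           (Seq (Add x x (k + 3)) (Sub (k + 2) 0 x))))"
  have "\<exists>R' M'. reach (While (k + 2) body) (S, M)
      (length xs * (poly (exp_cost a) (length xs) + 5 + 1) + 1) (R', M') \<and> P (length xs) R' M'"
  proof (rule reach_While)
    show "P 0 S M" using x by (auto simp: P_def S_def)
    show "P (length xs) R M \<Longrightarrow> R (k + 2) = 0" for R M by (simp add: P_def)
    fix i R1 M1 assume i: "i < length xs" and P: "P i R1 M1"
    have inp: "holds_input xs R1 M" using P x R0 M by (auto simp: P_def holds_input_def)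
    obtain R2 where 2: "reach (compile a (k + 3)) (R1, M) (poly (exp_cost a) (length xs)) (R2, M)"
      "R2 (k + 3) = eval xs R1 a" "\<forall>y<k + 3. R2 y = R1 y"
      using SumBelow.IH[of "k + 3" R1] wf wf_exp_mono[of a k "k + 3"] inp by auto
    have eq: "eval xs R1 a = eval xs (R(x := i)) a"
      using eval_cong[of a k R1 "R(x := i)"] P wf by (auto simp: P_def)
    define R3 where "R3 = R2(k := R2 k + R2 (k + 3), k + 3 := 1, x := i + 1, k + 2 := length xs - (i + 1))"
    have "R2 x = i" "R2 0 = length xs" using 2(3) P x R0 by (auto simp: P_def)
    then have "reach body (R1, M) (poly (exp_cost a) (length xs) + 5) (R3, M)"
      using reach_Seq[OF 2(1) reach_Seq[OF reach_Add[of k k "k + 3"] reach_Seq[OF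
        reach_Const[of "k + 3" 1] reach_Seq[OF reach_Add[of x x "k + 3"] reach_Sub[of "k + 2" 0 x]]]]] x
      by (simp add: body_def R3_def eval_nat_numeral)
    moreover have "P (Suc i) R3 M" using P 2 eq x by (auto simp: P_def R3_def)
    moreover have "R1 (k + 2) \<noteq> 0" using P i by (simp add: P_def)
    moreover have "M1 = M" using P by (simp add: P_def)
    ultimately show "R1 (k + 2) \<noteq> 0 \<and>
        (\<exists>R' M'. reach body (R1, M1) (poly (exp_cost a) (length xs) + 5) (R', M') \<and> P (Suc i) R' M')"
      by blast
  qed
  then obtain R4 where 4: "reach (While (k + 2) body) (S, M)
      (length xs * (poly (exp_cost a) (length xs) + 5 + 1) + 1) (R4, M)" "P (length xs) R4 M"
    unfolding P_def by blast
  have "reach (compile (SumBelow x a) k) (R, M) (1 + (2 + (1 + (2 +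
      (length xs * (poly (exp_cost a) (length xs) + 5 + 1) + 1 + 2))))) (R4(x := R4 (k + 1)), M)"
    using init[OF reach_Seq[OF 4(1)[unfolded body_def] reach_Move[of x "k + 1"]]] x by simp
  then show ?case by (rule compiled) (use 4(2) x in \<open>simp_all add: P_def\<close>)
qed

section \<open>Compiling output programs\<close>

datatype prog = Emit exp | Append prog prog | When exp prog | For nat prog

primrec out :: "nat list \<Rightarrow> (nat \<Rightarrow> nat) \<Rightarrow> prog \<Rightarrow> nat list" where
  "out xs R (Emit e) = [eval xs R e]"
| "out xs R (Append c d) = out xs R c @ out xs R d"
| "out xs R (When e c) = (if eval xs R e \<noteq> 0 then out xs R c else [])"
| "out xs R (For x c) = concat (map (\<lambda>v. out xs (R(x := v)) c) [0..<length xs])"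

primrec wf_prog :: "prog \<Rightarrow> nat \<Rightarrow> bool" where
  "wf_prog (Emit e) k \<longleftrightarrow> wf_exp e k"
| "wf_prog (Append c d) k \<longleftrightarrow> wf_prog c k \<and> wf_prog d k"
| "wf_prog (When e c) k \<longleftrightarrow> wf_exp e k \<and> wf_prog c k"
| "wf_prog (For x c) k \<longleftrightarrow> 2 \<le> x \<and> x < k \<and> wf_prog c k"

primrec compile_prog :: "prog \<Rightarrow> nat \<Rightarrow> com" where
  "compile_prog (Emit e) k =
     Seq (compile e k) (Seq (Store 1 k) (Seq (Const k 1) (Add 1 1 k)))"
| "compile_prog (Append c d) k = Seq (compile_prog c k) (compile_prog d k)"
| "compile_prog (When e c) k = Seq (compile e k) (If k (compile_prog c k) Skip)"
| "compile_prog (For x c) k =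
     Seq (Move k x) (Seq (Const x 0) (Seq (Move (k + 1) 0)
       (Seq (While (k + 1)
         (Seq (compile_prog c (k + 2)) (Seq (Const (k + 2) 1)
           (Seq (Add x x (k + 2)) (Sub (k + 1) 0 x)))))
         (Move x k))))"

primrec prog_cost :: "prog \<Rightarrow> nat poly" where
  "prog_cost (Emit e) = exp_cost e + [:4:]"
| "prog_cost (Append c d) = prog_cost c + prog_cost d"
| "prog_cost (When e c) = exp_cost e + prog_cost c + [:2:]"
| "prog_cost (For x c) = [:8:] + [:0, 1:] * (prog_cost c + [:5:])"

definition overwrite :: "(nat \<Rightarrow> nat) \<Rightarrow> nat \<Rightarrow> nat list \<Rightarrow> nat \<Rightarrow> nat" where
  "overwrite M p ys a = (if p \<le> a \<and> a < p + length ys then ys ! (a - p) else M a)"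

lemma overwrite_Nil: "overwrite M p [] = M"
  by (auto simp: overwrite_def)

lemma overwrite_single: "overwrite M p [y] = M(p := y)"
  by (auto simp: overwrite_def fun_eq_iff)

lemma overwrite_append: "overwrite (overwrite M p ys) (p + length ys) zs = overwrite M p (ys @ zs)"
  by (auto simp: overwrite_def fun_eq_iff nth_append)

lemma holds_input_overwrite:
  "holds_input xs R M \<Longrightarrow> R' 0 = R 0 \<Longrightarrow> length xs \<le> p \<Longrightarrow> holds_input xs R' (overwrite M p ys)"
  by (auto simp: holds_input_def overwrite_def)

lemma wf_prog_mono: "wf_prog c k \<Longrightarrow> k \<le> k' \<Longrightarrow> wf_prog c k'"
  by (induction c) (auto intro: wf_exp_mono)

lemma out_cong:
  "wf_prog c k \<Longrightarrow> \<forall>y. 2 \<le> y \<longrightarrow> y < k \<longrightarrow> R y = R' y \<Longrightarrow> out xs R c = out xs R' c"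
proof (induction c arbitrary: R R')
  case (Emit e)
  then show ?case using eval_cong[of e k R R'] by simp
next
  case (Append c d)
  from Append.IH(1)[of R R'] Append.IH(2)[of R R'] Append.prems show ?case by simp
next
  case (When e c)
  from When.IH(1)[of R R'] eval_cong[of e k R R'] When.prems show ?case by simp
next
  case (For x c)
  have "out xs (R(x := v)) c = out xs (R'(x := v)) c" for v
    by (rule For.IH) (use For.prems in auto)
  then show ?case by simp
qed

lemma compiled_prog:
  assumes "reach c (R, M) s (R', M')" "s \<le> s'" "M' = overwrite M (R 1) ys"
    "R' 1 = R 1 + length ys" "\<And>y. y < k \<Longrightarrow> y \<noteq> 1 \<Longrightarrow> R' y = R y"
  shows "\<exists>R'. reach c (R, M) s' (R', overwrite M (R 1) ys) \<and> R' 1 = R 1 + length ys \<and>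
    (\<forall>y<k. y \<noteq> 1 \<longrightarrow> R' y = R y)"
  using assms reach_mono by blast

text \<open>The pointer in register 1 must start behind the input, as otherwise emitted numbers
  would destroy what later expressions fetch. Register 1 is exempt from preservation because it
  advances with the output.\<close>

lemma compile_prog_correct:
  assumes "wf_prog c k" "2 \<le> k" "holds_input xs R M" "length xs \<le> R 1"
  shows "\<exists>R'. reach (compile_prog c k) (R, M) (poly (prog_cost c) (length xs))
      (R', overwrite M (R 1) (out xs R c)) \<and> R' 1 = R 1 + length (out xs R c) \<and>
    (\<forall>y<k. y \<noteq> 1 \<longrightarrow> R' y = R y)"
  using assms
proof (induction c arbitrary: k R M)
  case (Emit e)
  obtain R1 where 1: "reach (compile e k) (R, M) (poly (exp_cost e) (length xs)) (R1, M)"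
    "R1 k = eval xs R e" "\<forall>y<k. R1 y = R y"
    using compile_correct[of e k xs R M] Emit.prems by auto
  note run = reach_Seq[OF 1(1) reach_Seq[OF reach_Store[of 1 k]
    reach_Seq[OF reach_Const[of k 1] reach_Add[of 1 1 k]]]]
  show ?case
    unfolding compile_prog.simps
    by (rule compiled_prog[OF run]) (use 1 Emit.prems in \<open>simp_all add: overwrite_single\<close>)
next
  case (Append c d)
  obtain R1 where 1: "reach (compile_prog c k) (R, M) (poly (prog_cost c) (length xs))
      (R1, overwrite M (R 1) (out xs R c))" "R1 1 = R 1 + length (out xs R c)"
      "\<forall>y<k. y \<noteq> 1 \<longrightarrow> R1 y = R y"
    using Append.IH(1)[of k R M] Append.prems by auto
  obtain R2 where 2: "reach (compile_prog d k) (R1, overwrite M (R 1) (out xs R c))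
      (poly (prog_cost d) (length xs)) (R2, overwrite (overwrite M (R 1) (out xs R c)) (R1 1) (out xs R1 d))"
      "R2 1 = R1 1 + length (out xs R1 d)" "\<forall>y<k. y \<noteq> 1 \<longrightarrow> R2 y = R1 y"
    using Append.IH(2)[of k R1 "overwrite M (R 1) (out xs R c)"] Append.prems 1
      holds_input_overwrite[of xs R M R1 "R 1" "out xs R c"] by auto
  have eq: "out xs R1 d = out xs R d" using out_cong[of d k R1 R] 1(3) Append.prems by auto
  show ?case
    unfolding compile_prog.simps
    by (rule compiled_prog[OF reach_Seq[OF 1(1) 2(1)]])
      (use 1 2 eq in \<open>simp_all add: overwrite_append\<close>)
next
  case (When e c)
  obtain R1 where 1: "reach (compile e k) (R, M) (poly (exp_cost e) (length xs)) (R1, M)"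
    "R1 k = eval xs R e" "\<forall>y<k. R1 y = R y"
    using compile_correct[of e k xs R M] When.prems by auto
  have inp: "holds_input xs R1 M" "length xs \<le> R1 1"
    using 1(3) When.prems by (auto simp: holds_input_def)
  show ?case
  proof (cases "R1 k = 0")
    case True
    note run = reach_Seq[OF 1(1) reach_IfFalse[where R = R1 and x = k, OF True reach_Skip]]
    show ?thesis
      unfolding compile_prog.simps
      by (rule compiled_prog[OF run]) (use 1 True When.prems in \<open>simp_all add: overwrite_Nil\<close>)
  next
    case False
    obtain R2 where 2: "reach (compile_prog c k) (R1, M) (poly (prog_cost c) (length xs))
      (R2, overwrite M (R1 1) (out xs R1 c))" "R2 1 = R1 1 + length (out xs R1 c)"
      "\<forall>y<k. y \<noteq> 1 \<longrightarrow> R2 y = R1 y"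
      using When.IH[of k R1 M] When.prems inp by auto
    have eq: "out xs R1 c = out xs R c" using out_cong[of c k R1 R] 1(3) When.prems by auto
    note run = reach_Seq[OF 1(1) reach_IfTrue[where R = R1 and x = k, OF False 2(1)]]
    show ?thesis
      unfolding compile_prog.simps
      by (rule compiled_prog[OF run]) (use 1 2 eq False When.prems in simp_all)
  qed
next
  case (For x c)
  have x: "2 \<le> x" "x < k" and wf: "wf_prog c k" using For.prems by auto
  have R0: "R 0 = length xs" and M: "\<forall>a<length xs. M a = xs ! a" and R1: "length xs \<le> R 1"
    using For.prems by (auto simp: holds_input_def)
  define S where "S = R(k := R x, x := 0, k + 1 := length xs)"
  have init: "reach (Seq (Move k x) (Seq (Const x 0) (Seq (Move (k + 1) 0) d)))
      (R, M) (2 + (Suc 0 + (2 + s))) \<sigma>" if "reach d (S, M) s \<sigma>" for d s \<sigma>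
    by (rule reach_Seq[OF reach_Move reach_Seq[OF reach_Const reach_Seq[OF reach_Move]]])
      (use that x R0 in \<open>simp_all add: S_def\<close>)
  define ys where "ys i = concat (map (\<lambda>v. out xs (R(x := v)) c) [0..<i])" for i
  define P where "P i R1 M1 \<longleftrightarrow> M1 = overwrite M (R 1) (ys i) \<and> R1 1 = R 1 + length (ys i) \<and> R1 x = i \<and>
    R1 k = R x \<and> R1 (k + 1) = length xs - i \<and> (\<forall>y<k. y \<noteq> 1 \<longrightarrow> y \<noteq> x \<longrightarrow> R1 y = R y)"
    for i R1 M1
  define body where "body = Seq (compile_prog c (k + 2)) (Seq (Const (k + 2) 1)
           (Seq (Add x x (k + 2)) (Sub (k + 1) 0 x)))"
  have "\<exists>R' M'. reach (While (k + 1) body) (S, M)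
      (length xs * (poly (prog_cost c) (length xs) + 4 + 1) + 1) (R', M') \<and> P (length xs) R' M'"
  proof (rule reach_While)
    show "P 0 S M" using x For.prems(2) by (auto simp: P_def S_def ys_def overwrite_Nil)
    show "P (length xs) R M \<Longrightarrow> R (k + 1) = 0" for R M by (simp add: P_def)
    fix i R1 M1 assume i: "i < length xs" and P: "P i R1 M1"
    have R10: "R1 0 = R 0" and R11: "length xs \<le> R1 1" using P x R1 by (auto simp: P_def)
    have inp: "holds_input xs R1 M1"
      using holds_input_overwrite[where R = R and R' = R1, OF For.prems(3) R10 R1] P by (simp add: P_def)
    obtain R2 where 2: "reach (compile_prog c (k + 2)) (R1, M1) (poly (prog_cost c) (length xs))
      (R2, overwrite M1 (R1 1) (out xs R1 c))" "R2 1 = R1 1 + length (out xs R1 c)"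
      "\<forall>y<k + 2. y \<noteq> 1 \<longrightarrow> R2 y = R1 y"
      using For.IH[of "k + 2" R1 M1] wf wf_prog_mono[of c k "k + 2"] inp R11 by auto
    have eq: "out xs R1 c = out xs (R(x := i)) c"
      using out_cong[of c k R1 "R(x := i)"] P wf by (auto simp: P_def)
    have ys: "ys (Suc i) = ys i @ out xs R1 c" by (simp add: ys_def eq)
    define R3 where "R3 = R2(k + 2 := 1, x := i + 1, k + 1 := length xs - (i + 1))"
    have "R2 x = i" "R2 0 = length xs" using 2(3) P x R0 by (auto simp: P_def)
    then have "reach body (R1, M1) (poly (prog_cost c) (length xs) + 4)
        (R3, overwrite M1 (R1 1) (out xs R1 c))"
      using reach_Seq[OF 2(1) reach_Seq[OF
        reach_Const[of "k + 2" 1] reach_Seq[OF reach_Add[of x x "k + 2"] reach_Sub[of "k + 1" 0 x]]]] x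
      by (simp add: body_def R3_def eval_nat_numeral)
    moreover have "P (Suc i) R3 (overwrite M1 (R1 1) (out xs R1 c))"
      using P 2 ys x by (auto simp: P_def R3_def overwrite_append)
    moreover have "R1 (k + 1) \<noteq> 0" using P i by (simp add: P_def)
    ultimately show "R1 (k + 1) \<noteq> 0 \<and>
        (\<exists>R' M'. reach body (R1, M1) (poly (prog_cost c) (length xs) + 4) (R', M') \<and> P (Suc i) R' M')"
      by blast
  qed
  then obtain R4 where 4: "reach (While (k + 1) body) (S, M)
      (length xs * (poly (prog_cost c) (length xs) + 4 + 1) + 1)
      (R4, overwrite M (R 1) (ys (length xs)))" "P (length xs) R4 (overwrite M (R 1) (ys (length xs)))"
    unfolding P_def by blast
  have "reach (compile_prog (For x c) k) (R, M) (2 + (1 + (2 +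
      (length xs * (poly (prog_cost c) (length xs) + 4 + 1) + 1 + 2))))
      (R4(x := R4 k), overwrite M (R 1) (ys (length xs)))"
    using init[OF reach_Seq[OF 4(1)[unfolded body_def] reach_Move[of x k]]] x by simp
  then show ?case
    by (rule compiled_prog) (use 4(2) x in \<open>simp_all add: P_def ys_def\<close>)
qed

text \<open>Each emitted number costs at least one step, so the step bound also bounds the output
  length.\<close>

lemma length_out_le: "length (out xs R c) \<le> poly (prog_cost c) (length xs)"
proof (induction c arbitrary: R)
  case (Append c d)
  then show ?case by (simp add: add_mono)
next
  case (When e c)
  have "length (out xs R c) \<le> poly (prog_cost c) (length xs)" by (rule When)
  then show ?case by simp
next
  case (For x c)
  have "length (out xs R (For x c)) \<le> (\<Sum>v\<leftarrow>[0..<length xs]. poly (prog_cost c) (length xs))"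
    unfolding out.simps length_concat map_map comp_def by (intro sum_list_mono For)
  then show ?case by (simp add: sum_list_triv algebra_simps)
qed simp

section \<open>Moving the output to address 0\<close>

definition copy_down :: com where
  "copy_down = Seq (Move 2 0) (Seq (Const 3 0) (Seq (Const 4 1) (Seq (Sub 5 1 2)
     (Seq (While 5 (Seq (Load 6 2) (Seq (Store 3 6) (Seq (Add 2 2 4) (Seq (Add 3 3 4) (Sub 5 1 2))))))
       (Move 0 3)))))"

text \<open>Source and target areas may overlap, but copying in ascending order is safe: after
  \<open>i\<close> iterations only addresses below \<open>i\<close> have been written, and the next
  source address is \<open>R 0 + i\<close>.\<close>

lemma reach_copy_down:
  assumes "R 1 = R 0 + length ys" and M: "\<And>j. j < length ys \<Longrightarrow> M (R 0 + j) = ys ! j"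
  shows "\<exists>R' M'. reach copy_down (R, M) (6 * length ys + 9) (R', M') \<and> output_of (R', M') = ys"
proof -
  define S where "S = R(2 := R 0, 3 := 0, 4 := 1, 5 := length ys)"
  define body where "body = Seq (Load 6 2) (Seq (Store 3 6) (Seq (Add 2 2 4) (Seq (Add 3 3 4) (Sub 5 1 2))))"
  define P where "P i R1 M1 \<longleftrightarrow> R1 1 = R 1 \<and> R1 2 = R 0 + i \<and> R1 3 = i \<and> R1 4 = 1 \<and>
    R1 5 = length ys - i \<and> (\<forall>a. M1 a = (if a < i then ys ! a else M a))"
    for i :: nat and R1 M1 :: "nat \<Rightarrow> nat"
  have "\<exists>R' M'. reach (While 5 body) (S, M) (length ys * (5 + 1) + 1) (R', M') \<and> P (length ys) R' M'"
  proof (rule reach_While)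
    show "P 0 S M" using assms by (auto simp: P_def S_def)
    show "P (length ys) R M \<Longrightarrow> R 5 = 0" for R M by (simp add: P_def)
    fix i R1 M1 assume i: "i < length ys" and P: "P i R1 M1"
    have "M1 (R1 2) = ys ! i" using P M i by (auto simp: P_def)
    moreover have "reach body (R1, M1) 5
       (R1(6 := M1 (R1 2), 2 := R1 2 + R1 4, 3 := R1 3 + R1 4, 5 := R1 1 - (R1 2 + R1 4)),
        M1(R1 3 := M1 (R1 2)))"
      using reach_Seq[OF reach_Load[of 6 2 R1 M1] reach_Seq[OF reach_Store[of 3 6]
        reach_Seq[OF reach_Add[of 2 2 4] reach_Seq[OF reach_Add[of 3 3 4] reach_Sub[of 5 1 2]]]]]
      by (simp add: body_def eval_nat_numeral)
    moreover have "P (Suc i) (R1(6 := M1 (R1 2), 2 := R1 2 + R1 4, 3 := R1 3 + R1 4,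
        5 := R1 1 - (R1 2 + R1 4))) (M1(R1 3 := M1 (R1 2)))"
      using P i assms(1) \<open>M1 (R1 2) = ys ! i\<close> by (auto simp: P_def less_Suc_eq)
    moreover have "R1 5 \<noteq> 0" using P i by (simp add: P_def)
    ultimately show "R1 5 \<noteq> 0 \<and>
        (\<exists>R' M'. reach body (R1, M1) 5 (R', M') \<and> P (Suc i) R' M')"
      by blast
  qed
  then obtain R' M' where 1: "reach (While 5 body) (S, M) (length ys * (5 + 1) + 1) (R', M')"
    "P (length ys) R' M'" by blast
  have init: "reach (Seq (Move 2 0) (Seq (Const 3 0) (Seq (Const 4 1) (Seq (Sub 5 1 2) d))))
      (R, M) (2 + (Suc 0 + (Suc 1 + (1 + s)))) \<sigma>" if "reach d (S, M) s \<sigma>" for d s \<sigma>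
    by (rule reach_Seq[OF reach_Move reach_Seq[OF reach_Const reach_Seq[OF reach_Const
      reach_Seq[OF reach_Sub]]]]) (use that assms(1) in \<open>simp_all add: S_def\<close>)
  have "reach copy_down (R, M) (2 + (1 + (2 + (1 + (length ys * (5 + 1) + 1 + 2)))))
      (R'(0 := R' 3), M')"
    using init[OF reach_Seq[OF 1(1)[unfolded body_def] reach_Move[of 0 3]]]
    by (simp add: copy_down_def)
  then have "reach copy_down (R, M) (6 * length ys + 9) (R'(0 := R' 3), M')"
    by (rule reach_mono) simp
  moreover have "output_of (R'(0 := R' 3), M') = ys"
    using 1(2) by (auto simp: P_def intro!: nth_equalityI)
  ultimately show ?thesis by blast
qed

section \<open>From step counts to polynomial logarithmic cost\<close>

lemma poly_nat_mono: "x \<le> y \<Longrightarrow> poly p x \<le> poly (p :: nat poly) y"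
  by (induction p) (auto intro: add_mono mult_mono)

lemma length_le_bit_size: "length xs \<le> bit_size xs"
  by (induction xs) (auto simp: bit_size_def bit_length_def)

lemma bit_length_nth_le_bit_size: "a < length xs \<Longrightarrow> bit_length (xs ! a) \<le> bit_size xs"
  unfolding bit_size_def by (rule member_le_sum_list) auto

lemma bounded_initial_state: "bounded_state (bit_size xs) (initial_state xs)"
proof -
  have "length xs < 2 ^ bit_size xs"
    using length_le_bit_size[of xs] by (meson le_less_trans less_exp)
  moreover have "xs ! a < 2 ^ bit_size xs" if "a < length xs" for a
    using less_two_power_bit_length[of "xs ! a"] bit_length_nth_le_bit_size[OF that]
    by (meson less_le_trans one_le_numeral power_increasing)
  ultimately show ?thesis by (auto simp: bounded_state_def initial_state_def)
qed

text \<open>With input size \<open>X\<close> and \<open>poly q X\<close> steps, all numbers stay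
  below \<open>2 ^ (X + poly q X)\<close>, which bounds both the cost and the size of each output
  number. The registers \<open>R\<close> used to evaluate \<open>out\<close> are left open; a
  program without free variables does not depend on them.\<close>

lemma prog_in_polynomial_time:
  assumes "wf_prog c k" "2 \<le> k"
  shows "\<exists>m p. \<forall>xs. \<exists>t \<sigma> R. exec m (initial_state xs) t \<sigma> \<and> output_of \<sigma> = out xs R c \<and>
    t + bit_size (output_of \<sigma>) \<le> poly p (bit_size xs)"
proof -
  define m where "m = Seq (Move 1 0) (Seq (compile_prog c k) copy_down)"
  \<comment> \<open>11 is the initial move (2) plus the fixed cost of \<open>copy_down\<close> (9);
    7 is the run itself plus six steps per copied number, whose count is at most
    \<open>prog_cost c\<close>.\<close>
  define q where "q = [:11:] + [:7:] * prog_cost c"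
  \<comment> \<open>Of the factor 3, two parts pay for the running time and one for the output
    size.\<close>
  define p where "p = [:3:] * q * ([:0, 1:] + q + 1)"
  have "\<exists>t \<sigma> R. exec m (initial_state xs) t \<sigma> \<and> output_of \<sigma> = out xs R c \<and>
    t + bit_size (output_of \<sigma>) \<le> poly p (bit_size xs)" for xs
  proof -
    define L where "L = length xs"
    obtain R M where init: "initial_state xs = (R, M)" by fastforce
    then have R: "R 0 = L" and M: "\<And>a. a < L \<Longrightarrow> M a = xs ! a"
      by (auto simp: initial_state_def L_def)
    define R1 where "R1 = R(1 := L)"
    define ys where "ys = out xs R1 c"
    obtain R2 where 2: "reach (compile_prog c k) (R1, M) (poly (prog_cost c) L) (R2, overwrite M L ys)"
      "R2 1 = L + length ys" "\<forall>y<k. y \<noteq> 1 \<longrightarrow> R2 y = R1 y"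
      using compile_prog_correct[OF assms, of xs R1 M] R M
      by (auto simp: holds_input_def R1_def L_def ys_def)
    have R20: "R2 0 = L" using 2(3) assms(2) R by (simp add: R1_def)
    obtain R3 M3 where 3: "reach copy_down (R2, overwrite M L ys) (6 * length ys + 9) (R3, M3)"
      "output_of (R3, M3) = ys"
      using reach_copy_down[of R2 ys "overwrite M L ys"] 2(2) R20 by (auto simp: overwrite_def)
    have "reach m (R, M) (2 + (poly (prog_cost c) L + (6 * length ys + 9))) (R3, M3)"
      using reach_Seq[OF reach_Move[of 1 0 R M, unfolded R, folded R1_def] reach_Seq[OF 2(1) 3(1)]]
      by (simp add: m_def)
    moreover have ys: "length ys \<le> poly (prog_cost c) L"
      using length_out_le by (simp add: ys_def L_def)
    ultimately have run: "reach m (R, M) (poly q L) (R3, M3)"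
      by (auto elim!: reach_mono simp: q_def)
    define X where "X = bit_size xs"
    have "L \<le> X" using length_le_bit_size by (simp add: L_def X_def)
    then have "reach m (R, M) (poly q X) (R3, M3)"
      using run poly_nat_mono reach_mono by blast
    then obtain t where t: "exec m (R, M) t (R3, M3)" "t \<le> 2 * poly q X * (X + poly q X + 1)"
      and b: "bounded_state (X + poly q X) (R3, M3)"
      using bounded_initial_state[of xs] unfolding init reach_def X_def[symmetric] by blast
    have "bit_length y \<le> X + poly q X + 1" if y: "y \<in> set ys" for y
    proof -
      obtain a where "y = M3 a" using y unfolding 3(2)[symmetric] by auto
      then show ?thesis using bit_length_bounded_state(2)[OF b] by simp
    qed
    then have "bit_size ys \<le> (\<Sum>y\<leftarrow>ys. X + poly q X + 1)"
      unfolding bit_size_def by (intro sum_list_mono) auto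
    also have "\<dots> = length ys * (X + poly q X + 1)" by (simp add: sum_list_triv)
    also have "\<dots> \<le> poly q X * (X + poly q X + 1)"
    proof (rule mult_right_mono)
      have "length ys \<le> poly q L" using ys by (simp add: q_def)
      then show "length ys \<le> poly q X" using poly_nat_mono[OF \<open>L \<le> X\<close>] le_trans by blast
    qed simp
    finally have "t + bit_size ys \<le> poly p X" using t(2) by (simp add: p_def algebra_simps)
    then show ?thesis using t(1) 3(2) init X_def ys_def by metis
  qed
  then show ?thesis by blast
qed

section \<open>Logical connectives and products\<close>

text \<open>Nonzero means true, and the truncated difference \<open>b - a\<close> is nonzero exactly
  if \<open>a < b\<close>.\<close>

definition Less :: "exp \<Rightarrow> exp \<Rightarrow> exp" where "Less a b = Minus b a"
definition Neg :: "exp \<Rightarrow> exp" where "Neg a = Cond a (Num 0) (Num 1)"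
definition Conj :: "exp \<Rightarrow> exp \<Rightarrow> exp" where "Conj a b = Cond a b (Num 0)"
definition Disj :: "exp \<Rightarrow> exp \<Rightarrow> exp" where "Disj a b = Cond a (Num 1) b"
definition Imp :: "exp \<Rightarrow> exp \<Rightarrow> exp" where "Imp a b = Cond a b (Num 1)"
definition Leq :: "exp \<Rightarrow> exp \<Rightarrow> exp" where "Leq a b = Neg (Less b a)"
definition Eql :: "exp \<Rightarrow> exp \<Rightarrow> exp" where "Eql a b = Conj (Leq a b) (Leq b a)"
definition Forall :: "nat \<Rightarrow> exp \<Rightarrow> exp" where "Forall x a = Neg (SumBelow x (Neg a))"

definition holds :: "nat list \<Rightarrow> (nat \<Rightarrow> nat) \<Rightarrow> exp \<Rightarrow> bool" where
  "holds xs R e \<longleftrightarrow> eval xs R e \<noteq> 0"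

lemma eval_Cond: "eval xs R (Cond a b c) = (if holds xs R a then eval xs R b else eval xs R c)"
  by (simp add: holds_def)

lemma out_When: "out xs R (When e c) = (if holds xs R e then out xs R c else [])"
  by (simp add: holds_def)

lemma holds_connectives:
  "holds xs R (Less a b) \<longleftrightarrow> eval xs R a < eval xs R b"
  "holds xs R (Leq a b) \<longleftrightarrow> eval xs R a \<le> eval xs R b"
  "holds xs R (Eql a b) \<longleftrightarrow> eval xs R a = eval xs R b"
  "holds xs R (Neg a) \<longleftrightarrow> \<not> holds xs R a"
  "holds xs R (Conj a b) \<longleftrightarrow> holds xs R a \<and> holds xs R b"
  "holds xs R (Disj a b) \<longleftrightarrow> holds xs R a \<or> holds xs R b"
  "holds xs R (Imp a b) \<longleftrightarrow> (holds xs R a \<longrightarrow> holds xs R b)"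
  "holds xs R (Forall x a) \<longleftrightarrow> (\<forall>v<length xs. holds xs (R(x := v)) a)"
  by (auto simp: holds_def Less_def Leq_def Eql_def Neg_def Conj_def Disj_def Imp_def Forall_def)

lemma wf_connectives:
  "wf_exp (Less a b) k \<longleftrightarrow> wf_exp a k \<and> wf_exp b k"
  "wf_exp (Leq a b) k \<longleftrightarrow> wf_exp a k \<and> wf_exp b k"
  "wf_exp (Eql a b) k \<longleftrightarrow> wf_exp a k \<and> wf_exp b k"
  "wf_exp (Neg a) k \<longleftrightarrow> wf_exp a k"
  "wf_exp (Conj a b) k \<longleftrightarrow> wf_exp a k \<and> wf_exp b k"
  "wf_exp (Disj a b) k \<longleftrightarrow> wf_exp a k \<and> wf_exp b k"
  "wf_exp (Imp a b) k \<longleftrightarrow> wf_exp a k \<and> wf_exp b k"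
  "wf_exp (Forall x a) k \<longleftrightarrow> 2 \<le> x \<and> x < k \<and> wf_exp a k"
  by (auto simp: Less_def Leq_def Eql_def Neg_def Conj_def Disj_def Imp_def Forall_def)

lemma sum_if_less:
  fixes f :: "nat \<Rightarrow> nat"
  assumes "n \<le> l"
  shows "(\<Sum>v<l. if v < n then f v else 0) = (\<Sum>v<n. f v)"
proof -
  have "(\<Sum>v<l. if v < n then f v else 0) = (\<Sum>v\<in>{v\<in>{..<l}. v < n}. f v)"
    by (subst sum.inter_filter) auto
  also have "{v\<in>{..<l}. v < n} = {..<n}" using assms by auto
  finally show ?thesis .
qed

text \<open>Multiplication as repeated addition over addresses. It is correct only if the first
  factor is at most the input length and neither factor depends on the bound register 9.\<close>

definition Times :: "exp \<Rightarrow> exp \<Rightarrow> exp" where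
  "Times a b = SumBelow 9 (Cond (Less (Var 9) a) b (Num 0))"

lemma eval_Times:
  assumes "\<And>v. eval xs (R(9 := v)) a = eval xs R a" "\<And>v. eval xs (R(9 := v)) b = eval xs R b"
    "eval xs R a \<le> length xs"
  shows "eval xs R (Times a b) = eval xs R a * eval xs R b"
  using sum_if_less[OF assms(3), of "\<lambda>_. eval xs R b"]
  by (simp add: Times_def eval_Cond holds_connectives assms(1,2) del: eval.simps(6) cong: if_cong)

section \<open>Reading the input\<close>

lemma concat_uniform:
  assumes "\<And>i. i < m \<Longrightarrow> length (f i) = l"
  shows "length (concat (map f [0..<m])) = m * l"
    and "i < m \<Longrightarrow> j < l \<Longrightarrow> concat (map f [0..<m]) ! (i * l + j) = f i ! j"
proof -
  have len: "length (concat (map f [0..<k])) = k * l" if "k \<le> m" for k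
    using that by (induction k) (auto simp: assms)
  from len[of m] show "length (concat (map f [0..<m])) = m * l" by simp
  have "concat (map f [0..<k]) ! (i * l + j) = f i ! j" if "k \<le> m" "i < k" "j < l" for k i j
    using that
  proof (induction k)
    case (Suc k)
    show ?case
    proof (cases "i < k")
      case True
      have "i * l + j < Suc i * l" using Suc.prems by simp
      also have "\<dots> \<le> k * l" using True by (intro mult_le_mono1) simp
      finally have "i * l + j < length (concat (map f [0..<k]))" using len[of k] Suc.prems by simp
      then show ?thesis using Suc True by (simp add: nth_append)
    next
      case False
      then have "i = k" using Suc.prems by simp
      then show ?thesis using len[of k] Suc.prems by (simp add: nth_append)
    qed
  qed simp
  then show "i < m \<Longrightarrow> j < l \<Longrightarrow> concat (map f [0..<m]) ! (i * l + j) = f i ! j" by blast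
qed

lemma concat_concat_map: "concat (concat (map f xs)) = concat (map (\<lambda>x. concat (f x)) xs)"
  by (induction xs) auto

locale simultaneous =
  fixes I :: "(nat, nat, nat) mrmd" and n m q :: nat
  assumes is_instance: "mrmd_instance I"
    and demands: "demands I = {..<n}" and rtypes: "rtypes I = {..<m}"
    and all_starts: "all_starts I = {..<q}"
    and one_or_all: "one_or_all I"
    and zero_travel_times: "zero_travel_times I"
    and infinite_service_times: "infinite_service_times I"
begin

abbreviation xs :: "nat list" where "xs \<equiv> encode_instance I"

text \<open>The default 0 agrees with the pair \<open>[0, 0]\<close> of the encoding, so sums over
  supplies can range over all locations below \<open>q\<close>.\<close>

definition cap :: "nat \<Rightarrow> nat \<Rightarrow> nat" where
  "cap r s = (if s \<in> starts I r then capacity I r s else 0)"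

definition cells where
  "cells r = concat (map (\<lambda>s. if s \<in> starts I r then [1, capacity I r s] else [0, 0]) [0..<q])"

definition row where
  "row d = map (\<lambda>r. of_bool (r \<in> required I d)) [0..<m] @
     [start_time I d, encode_duration (duration I d), reward I d]"

definition travel_times where
  "travel_times = concat (map (\<lambda>x. map (travel I x) (map Start [0..<q] @ map Site [0..<n]))
     (map Start [0..<q] @ map Site [0..<n]))"

lemma encode_instance_eq:
  "xs = [n, m, q] @ concat (map cells [0..<m]) @ concat (map row [0..<n]) @ travel_times"
  by (simp add: encode_instance_def Let_def demands rtypes all_starts cells_def[abs_def] row_def[abs_def]
      travel_times_def concat_concat_map comp_def)

lemma length_cells: "length (cells r) = 2 * q"
proof -
  have "length (cells r) = q * 2" unfolding cells_def by (rule concat_uniform) simp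
  then show ?thesis by simp
qed

lemma length_row: "length (row d) = m + 3"
  by (simp add: row_def)

lemma length_xs: "length xs = 3 + m * (2 * q) + n * (m + 3) + (q + n) * (q + n)"
proof -
  have "length travel_times = (q + n) * (q + n)"
    by (simp add: travel_times_def length_concat comp_def sum_list_triv algebra_simps)
  then show ?thesis
    using concat_uniform(1)[of m cells, OF length_cells] concat_uniform(1)[of n row, OF length_row]
    by (simp add: encode_instance_eq)
qed

lemma xs_header: "xs ! 0 = n" "xs ! 1 = m" "xs ! 2 = q"
  by (simp_all add: encode_instance_eq)

text \<open>Loops range over the addresses of the input, so these inequalities ensure that they
  reach every demand, location and type. The first is strict because a threshold can equal
  \<open>n\<close>. Without demands and locations the input has three entries for any
  \<open>m\<close>, hence the condition \<open>0 < n\<close>.\<close>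

lemma bounds: "n < length xs" "q \<le> length xs" "0 < n \<Longrightarrow> m \<le> length xs" "3 \<le> length xs"
proof -
  have "q \<le> (q + n) * (q + n)" by (rule order_trans[OF le_square]) (simp add: mult_le_mono)
  then show "q \<le> length xs" by (simp add: length_xs)
  have "n * 1 \<le> n * (m + 3)" by (intro mult_le_mono2) simp
  then show "n < length xs" unfolding length_xs by linarith
  show "m \<le> length xs" if "0 < n"
  proof -
    have "m \<le> 1 * (m + 3)" by simp
    also have "\<dots> \<le> n * (m + 3)" using that by (intro mult_le_mono1) simp
    also have "\<dots> \<le> length xs" unfolding length_xs by simp
    finally show ?thesis .
  qed
  show "3 \<le> length xs" by (simp add: length_xs)
qed

text \<open>The 4 skips the three header numbers and the membership flag in front of the capacity.
  Cells have two entries, and doubling is written as a sum to match \<open>cap_exp\<close>.\<close>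

lemma xs_capacity:
  assumes "r < m" "s < q"
  shows "4 + (r * q + s) + (r * q + s) < length xs" "xs ! (4 + (r * q + s) + (r * q + s)) = cap r s"
proof -
  have "r * q + s < m * q"
  proof -
    have "r * q + s < Suc r * q" using assms by simp
    also have "\<dots> \<le> m * q" using assms by (intro mult_le_mono1) simp
    finally show ?thesis .
  qed
  then have lt: "r * (2 * q) + (s * 2 + 1) < m * (2 * q)" by simp
  have address: "4 + (r * q + s) + (r * q + s) = 3 + (r * (2 * q) + (s * 2 + 1))"
    by (simp add: algebra_simps)
  show "4 + (r * q + s) + (r * q + s) < length xs"
    unfolding address length_xs using lt by linarith
  have "xs ! (4 + (r * q + s) + (r * q + s)) = xs ! (3 + (r * (2 * q) + (s * 2 + 1)))"
    unfolding address ..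
  also have "\<dots> = concat (map cells [0..<m]) ! (r * (2 * q) + (s * 2 + 1))"
    using lt concat_uniform(1)[of m cells, OF length_cells]
    by (simp add: encode_instance_eq nth_append eval_nat_numeral)
  also have "\<dots> = cells r ! (s * 2 + 1)"
    by (rule concat_uniform(2)) (use assms length_cells in auto)
  also have "\<dots> = (if s \<in> starts I r then [1, capacity I r s] else [0, 0]) ! 1"
    unfolding cells_def by (rule concat_uniform(2)) (use assms in auto)
  also have "\<dots> = cap r s" by (simp add: cap_def)
  finally show "xs ! (4 + (r * q + s) + (r * q + s)) = cap r s" .
qed

lemma xs_row:
  assumes "d < n" "j < m + 3"
  shows "3 + (q * m + q * m + d * (m + 3)) + j < length xs"
    "xs ! (3 + (q * m + q * m + d * (m + 3)) + j) = row d ! j"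
proof -
  have "d * (m + 3) + j < Suc d * (m + 3)" using assms by simp
  also have "\<dots> \<le> n * (m + 3)" using assms by (intro mult_le_mono1) simp
  finally have lt: "d * (m + 3) + j < n * (m + 3)" .
  have address: "3 + (q * m + q * m + d * (m + 3)) + j = 3 + (m * (2 * q) + (d * (m + 3) + j))"
    by (simp add: algebra_simps)
  show "3 + (q * m + q * m + d * (m + 3)) + j < length xs"
    unfolding address length_xs using lt by linarith
  have "xs ! (3 + (q * m + q * m + d * (m + 3)) + j) = xs ! (3 + (m * (2 * q) + (d * (m + 3) + j)))"
    unfolding address ..
  also have "\<dots> = concat (map row [0..<n]) ! (d * (m + 3) + j)"
    using lt concat_uniform(1)[of m cells, OF length_cells]
      concat_uniform(1)[of n row, OF length_row]
    by (simp add: encode_instance_eq nth_append eval_nat_numeral)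
  also have "\<dots> = row d ! j"
    by (rule concat_uniform(2)) (use assms length_row in auto)
  finally show "xs ! (3 + (q * m + q * m + d * (m + 3)) + j) = row d ! j" .
qed

end

section \<open>The algorithm\<close>

definition n_exp :: exp where "n_exp = Fetch (Num 0)"
definition m_exp :: exp where "m_exp = Fetch (Num 1)"
definition q_exp :: exp where "q_exp = Fetch (Num 2)"

text \<open>Arguments of type \<open>nat\<close> name the registers that hold the values.  Register \<open>2\<close> is always
  the current demand, and \<open>4\<close>, \<open>5\<close>, \<open>6\<close> are the current resource type, starting location and
  threshold; registers \<open>3\<close>, \<open>7\<close>, \<open>8\<close>, \<open>9\<close>, \<open>10\<close> are bound inside expressions.\<close>

definition cap_exp :: "nat \<Rightarrow> nat \<Rightarrow> exp" where
  "cap_exp r s = (let t = Plus (Times (Var r) q_exp) (Var s) in Fetch (Plus (Plus (Num 4) t) t))"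

definition row_exp :: "nat \<Rightarrow> exp" where
  "row_exp d = Plus (Num 3) (Plus (Plus (Times q_exp m_exp) (Times q_exp m_exp))
     (Times (Var d) (Plus m_exp (Num 3))))"

definition required_exp :: "nat \<Rightarrow> nat \<Rightarrow> exp" where
  "required_exp d r = Fetch (Plus (row_exp d) (Var r))"

definition reward_exp :: "nat \<Rightarrow> exp" where
  "reward_exp d = Fetch (Plus (row_exp d) (Plus m_exp (Num 2)))"

definition stock_exp :: "nat \<Rightarrow> exp" where
  "stock_exp r = SumBelow 10 (Cond (Less (Var 10) q_exp) (cap_exp r 10) (Num 0))"

definition prefix_exp :: exp where
  "prefix_exp = SumBelow 10 (Cond (Less (Var 10) (Var 5)) (cap_exp 4 10) (Num 0))"

definition all_types_exp :: exp where
  "all_types_exp = Forall 7 (Imp (Less (Var 7) m_exp) (required_exp 2 7))"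

definition ahead_exp :: exp where
  "ahead_exp = Conj
     (Forall 7 (Imp (Less (Var 7) m_exp) (Eql (required_exp 3 7) (required_exp 2 7))))
     (Disj (Less (reward_exp 2) (reward_exp 3))
       (Conj (Eql (reward_exp 3) (reward_exp 2)) (Less (Var 3) (Var 2))))"

definition position_exp :: "nat \<Rightarrow> exp" where
  "position_exp k = Plus (Cond all_types_exp (Num 0) (Var k))
     (SumBelow 3 (Cond (Less (Var 3) n_exp) (Cond ahead_exp (Num 1) (Num 0)) (Num 0)))"

definition selected_exp :: "nat \<Rightarrow> exp" where
  "selected_exp k = Conj (Imp all_types_exp (Less (position_exp k) (Var k)))
     (Forall 7 (Imp (Less (Var 7) m_exp) (Imp (required_exp 2 7) (Less (position_exp k) (stock_exp 7)))))"

definition value_exp :: "nat \<Rightarrow> exp" where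
  "value_exp k = SumBelow 2 (Cond (Less (Var 2) n_exp)
     (Cond (selected_exp k) (reward_exp 2) (Num 0)) (Num 0))"

definition best_exp :: exp where
  "best_exp = Forall 8 (Disj (Less (value_exp 8) (value_exp 6))
     (Conj (Eql (value_exp 8) (value_exp 6)) (Leq (Var 6) (Var 8))))"

definition slot_exp :: exp where
  "slot_exp = Conj (Leq prefix_exp (position_exp 6))
     (Less (position_exp 6) (Plus prefix_exp (cap_exp 4 5)))"

definition count_exp :: exp where
  "count_exp = SumBelow 2 (Cond (Less (Var 2) n_exp) (Cond (selected_exp 6)
     (SumBelow 4 (Cond (Less (Var 4) m_exp) (Cond (required_exp 2 4)
       (SumBelow 5 (Cond (Less (Var 5) q_exp) (Cond slot_exp (Num 1) (Num 0)) (Num 0)))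
     (Num 0)) (Num 0))) (Num 0)) (Num 0))"

definition entry_prog :: prog where
  "entry_prog = Append (Emit (Var 4)) (Append (Emit (Var 5))
     (Append (Emit (Minus (position_exp 6) prefix_exp)) (Append (Emit (Num 1)) (Emit (Var 2)))))"

text \<open>The language cannot store a value. Instead, the outer loop tries all \<open>k\<close>,
  and \<open>best_exp\<close> lets exactly one pass, which binds register 6 to the optimal
  threshold. An encoded plan starts with its length, so \<open>count_exp\<close> repeats the loops
  below it as sums.\<close>

definition solve_prog :: prog where
  "solve_prog = For 6 (When best_exp (Append (Emit count_exp)
     (For 2 (When (Less (Var 2) n_exp) (When (selected_exp 6)
       (For 4 (When (Less (Var 4) m_exp) (When (required_exp 2 4)
         (For 5 (When (Less (Var 5) q_exp) (When slot_exp entry_prog)))))))))))"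

lemmas wf_defs = n_exp_def m_exp_def q_exp_def cap_exp_def row_exp_def required_exp_def
  reward_exp_def stock_exp_def prefix_exp_def all_types_exp_def ahead_exp_def position_exp_def
  selected_exp_def value_exp_def best_exp_def slot_exp_def count_exp_def Times_def Let_def

text \<open>The largest variable is register 10, so scratch registers start at 11.\<close>

lemma wf_solve_prog: "wf_prog solve_prog 11"
  unfolding solve_prog_def entry_prog_def wf_defs by (simp add: wf_connectives)

lemma concat_map_if_less:
  "n \<le> l \<Longrightarrow> concat (map (\<lambda>v. if v < n then f v else []) [0..<l]) = concat (map f [0..<n])"
proof (induction l)
  case (Suc l)
  show ?case
  proof (cases "n = Suc l")
    case True
    have "map (\<lambda>v. if v < n then f v else []) [0..<Suc l] = map f [0..<Suc l]"
      using True by (intro map_cong) auto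
    then show ?thesis by (simp only: True)
  qed (use Suc in auto)
qed simp

text \<open>A loop guarded by a condition with a single solution acts as a let binding of that
  solution.\<close>

lemma concat_map_unique:
  assumes "k < l" "P k" "\<And>v. v < l \<Longrightarrow> P v \<Longrightarrow> v = k"
  shows "concat (map (\<lambda>v. if P v then f v else []) [0..<l]) = f k"
proof -
  have split: "[0..<l] = [0..<k] @ k # [Suc k..<l]"
    using assms(1) upt_add_eq_append[of 0 k "l - k"] upt_conv_Cons[of k l] by simp
  have none: "\<not> P v" if "v < l" "v \<noteq> k" for v
    using assms(3) that by blast
  have nil: "concat (map (\<lambda>v. if P v then f v else []) ys) = []"
    if "\<forall>v\<in>set ys. \<not> P v" for ys
    using that by (induction ys) auto
  have "concat (map (\<lambda>v. if P v then f v else []) [0..<k]) = []"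
    "concat (map (\<lambda>v. if P v then f v else []) [Suc k..<l]) = []"
    using assms(1) none by (auto intro!: nil)
  then show ?thesis using assms(2) by (simp only: split map_append list.map concat_append concat.simps)
      (simp only: if_True append_Nil append_Nil2)
qed

context simultaneous
begin

text \<open>Decreasing reward, with ties broken by number; without the tie-break, ranks within a
  group would collide.\<close>

definition ahead :: "nat \<Rightarrow> nat \<Rightarrow> bool" where
  "ahead d' d \<longleftrightarrow> reward I d < reward I d' \<or> reward I d' = reward I d \<and> d' < d"

text \<open>The index, counted from 0, that \<open>d\<close> would have if its group were sorted by
  \<open>ahead\<close>; counting replaces sorting.\<close>

definition rank :: "nat \<Rightarrow> nat" where
  "rank d = card {d'. d' < n \<and> required I d' = required I d \<and> ahead d' d}"

definition stock :: "nat \<Rightarrow> nat" where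
  "stock r = (\<Sum>s<q. cap r s)"

definition prefix_stock :: "nat \<Rightarrow> nat \<Rightarrow> nat" where
  "prefix_stock r s = (\<Sum>s'<s. cap r s')"

text \<open>Among the resources of each type, the first \<open>k\<close> are set aside for demands that require
  all types.\<close>

definition position :: "nat \<Rightarrow> nat \<Rightarrow> nat" where
  "position k d = (if required I d = rtypes I then 0 else k) + rank d"

text \<open>The stock condition is imposed on both kinds of demands, so that a \<open>k\<close>
  exceeding some supply just selects fewer demands and still gives a feasible plan.\<close>

definition selected :: "nat \<Rightarrow> nat \<Rightarrow> bool" where
  "selected k d \<longleftrightarrow> (required I d = rtypes I \<longrightarrow> position k d < k) \<and>
     (\<forall>r\<in>required I d. position k d < stock r)"

definition threshold_value :: "nat \<Rightarrow> nat" where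
  "threshold_value k = (\<Sum>d<n. if selected k d then reward I d else 0)"

text \<open>The resources of type \<open>r\<close> are lined up location by location;
  \<open>s\<close> owns the interval of length \<open>cap r s\<close> that starts at
  \<open>prefix_stock r s\<close>.\<close>

definition slot :: "nat \<Rightarrow> nat \<Rightarrow> nat \<Rightarrow> nat \<Rightarrow> bool" where
  "slot k d r s \<longleftrightarrow> prefix_stock r s \<le> position k d \<and> position k d < prefix_stock r s + cap r s"

text \<open>Maximal value with ties going to the smallest \<open>k\<close>, so that exactly one
  threshold below \<open>length xs\<close> qualifies.\<close>

definition best :: "nat \<Rightarrow> bool" where
  "best k \<longleftrightarrow> (\<forall>k'<length xs. threshold_value k' < threshold_value k \<or>
     threshold_value k' = threshold_value k \<and> k \<le> k')"

text \<open>The nesting follows the loops of \<open>solve_prog\<close>, so that the output equals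
  the encoding of this very list, order included.\<close>

definition plan :: "nat \<Rightarrow> plan_list" where
  "plan k = concat (map (\<lambda>d. if selected k d then
     concat (map (\<lambda>r. if r \<in> required I d then
       concat (map (\<lambda>s. if slot k d r s then
         [((r, s, position k d - prefix_stock r s), [d])] else []) [0..<q]) else []) [0..<m])
     else []) [0..<n])"

section \<open>Values of the expressions on an encoded instance\<close>

lemma eval_header:
  "eval xs R n_exp = n" "eval xs R m_exp = m" "eval xs R q_exp = q"
  using bounds(4) xs_header by (auto simp: n_exp_def m_exp_def q_exp_def)

lemma required_subset: "d < n \<Longrightarrow> required I d \<subseteq> {..<m}"
  using is_instance demands rtypes by (auto simp: mrmd_instance_def)

lemma required_nonempty: "d < n \<Longrightarrow> required I d \<noteq> {}"
  using is_instance demands by (auto simp: mrmd_instance_def)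

text \<open>Here and below, inequalities between register names exclude capture by registers bound
  inside the expressions, such as 9 in \<open>Times\<close>.\<close>

lemma eval_cap_exp:
  assumes "R r < m" "R s < q" "r \<noteq> 9" "s \<noteq> 9" "R r \<le> length xs"
  shows "eval xs R (cap_exp r s) = cap (R r) (R s)"
  using xs_capacity[OF assms(1,2)] assms(3-)
  by (simp add: cap_exp_def Let_def eval_Times eval_header)

lemma eval_row_exp:
  "R d < n \<Longrightarrow> d \<noteq> 9 \<Longrightarrow>
    eval xs R (row_exp d) = 3 + (q * m + q * m + R d * (m + 3))"
  using bounds by (simp add: row_exp_def eval_Times eval_header)

text \<open>The exact value is needed besides its truth, because \<open>ahead_exp\<close> compares
  two such flags for equality.\<close>

lemma eval_required_exp:
  assumes "R d < n" "R r < m" "d \<noteq> 9"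
  shows "eval xs R (required_exp d r) = of_bool (R r \<in> required I (R d))"
  using xs_row[OF assms(1), of "R r"] assms
  by (simp add: required_exp_def eval_row_exp row_def nth_append)

lemma holds_required_exp:
  assumes "R d < n" "R r < m" "d \<noteq> 9"
  shows "holds xs R (required_exp d r) \<longleftrightarrow> R r \<in> required I (R d)"
  using eval_required_exp[of R d r] assms by (simp add: holds_def)

lemma eval_reward_exp:
  assumes "R d < n" "d \<noteq> 9"
  shows "eval xs R (reward_exp d) = reward I (R d)"
  using xs_row[OF assms(1), of "m + 2"] assms
  by (simp add: reward_exp_def eval_row_exp row_def nth_append eval_header)

lemma eval_stock_exp:
  assumes "R r < m" "R r \<le> length xs" "r \<noteq> 9" "r \<noteq> 10"
  shows "eval xs R (stock_exp r) = stock (R r)"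
  using assms sum_if_less[OF bounds(2), of "cap (R r)"]
  by (simp add: stock_exp_def stock_def eval_Cond holds_connectives eval_header eval_cap_exp
      del: eval.simps(6) cong: if_cong)

lemma eval_prefix_exp:
  assumes "R 4 < m" "R 4 \<le> length xs" "R 5 < q"
  shows "eval xs R prefix_exp = prefix_stock (R 4) (R 5)"
  using assms sum_if_less[of "R 5" "length xs" "cap (R 4)"] bounds(2)
  by (simp add: prefix_exp_def prefix_stock_def eval_Cond holds_connectives eval_cap_exp
      del: eval.simps(6) cong: if_cong)

lemma holds_all_types_exp:
  assumes "R 2 < n"
  shows "holds xs R all_types_exp \<longleftrightarrow> required I (R 2) = rtypes I"
  using assms required_subset[OF assms] bounds(3)
  by (auto simp: all_types_exp_def holds_connectives eval_header holds_required_exp rtypes)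

lemma holds_ahead_exp:
  assumes "R 2 < n" "R 3 < n"
  shows "holds xs R ahead_exp \<longleftrightarrow> required I (R 3) = required I (R 2) \<and> ahead (R 3) (R 2)"
proof -
  have "(\<forall>r<m. (r \<in> required I (R 3)) = (r \<in> required I (R 2))) \<longleftrightarrow>
      required I (R 3) = required I (R 2)"
    using required_subset assms by blast
  moreover have "m \<le> length xs" using assms bounds(3) by simp
  ultimately show ?thesis
    using assms
    by (auto simp: ahead_exp_def holds_connectives eval_header eval_required_exp eval_reward_exp
        ahead_def of_bool_def split: if_splits)
qed

lemma eval_position_exp:
  assumes "R 2 < n" "k \<noteq> 3"
  shows "eval xs R (position_exp k) = position (R k) (R 2)"
proof -
  have "eval xs R (SumBelow 3 (Cond (Less (Var 3) n_exp) (Cond ahead_exp (Num 1) (Num 0)) (Num 0))) =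
      (\<Sum>v<n. if required I v = required I (R 2) \<and> ahead v (R 2) then 1 else 0)"
    using assms sum_if_less[of n "length xs"
        "\<lambda>v. if required I v = required I (R 2) \<and> ahead v (R 2) then 1 else 0"] bounds(1)
    by (simp add: eval_Cond holds_connectives eval_header holds_ahead_exp
        del: eval.simps(6) cong: if_cong)
  also have "\<dots> = rank (R 2)"
    unfolding rank_def by (subst sum.inter_filter[symmetric]) (auto simp: conj_commute)
  finally show ?thesis
    using assms
    by (simp add: position_exp_def position_def eval_Cond holds_all_types_exp
        del: eval.simps(6,7))
qed

lemma holds_selected_exp:
  assumes "R 2 < n" "k \<noteq> 3" "k \<noteq> 7"
  shows "holds xs R (selected_exp k) \<longleftrightarrow> selected (R k) (R 2)"
  using assms required_subset[OF assms(1)] bounds(3)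
  by (auto simp: selected_exp_def selected_def holds_connectives eval_header holds_required_exp
      holds_all_types_exp eval_position_exp eval_stock_exp)

lemma eval_value_exp:
  assumes "k \<noteq> 2" "k \<noteq> 3" "k \<noteq> 7"
  shows "eval xs R (value_exp k) = threshold_value (R k)"
  using assms sum_if_less[of n "length xs" "\<lambda>d. if selected (R k) d then reward I d else 0"]
    bounds(1)
  by (simp add: value_exp_def threshold_value_def eval_Cond holds_connectives eval_header
      holds_selected_exp eval_reward_exp del: eval.simps(6) cong: if_cong)

lemma holds_best_exp: "holds xs R best_exp \<longleftrightarrow> best (R 6)"
  by (simp add: best_exp_def best_def holds_connectives eval_value_exp)

lemma holds_slot_exp:
  assumes "R 2 < n" "R 4 < m" "R 5 < q"
  shows "holds xs R slot_exp \<longleftrightarrow> slot (R 6) (R 2) (R 4) (R 5)"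
  using assms bounds(3)
  by (simp add: slot_exp_def slot_def holds_connectives eval_position_exp eval_prefix_exp
      eval_cap_exp)

lemma length_plan:
  "length (plan k) = (\<Sum>d<n. if selected k d then
     (\<Sum>r<m. if r \<in> required I d then (\<Sum>s<q. if slot k d r s then 1 else 0) else 0) else 0)"
  by (simp add: plan_def length_concat comp_def if_distrib[of length] interv_sum_list_conv_sum_set_nat
      atLeast0LessThan cong: if_cong)

lemma eval_count_exp: "eval xs R count_exp = length (plan (R 6))"
proof -
  have 1: "eval xs R (SumBelow 5 (Cond (Less (Var 5) q_exp) (Cond slot_exp (Num 1) (Num 0)) (Num 0))) =
      (\<Sum>s<q. if slot (R 6) (R 2) (R 4) s then 1 else 0)" if "R 2 < n" "R 4 < m" for R
    using that sum_if_less[OF bounds(2), of "\<lambda>s. if slot (R 6) (R 2) (R 4) s then 1 else 0"]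
    by (simp add: eval_Cond holds_connectives eval_header holds_slot_exp
        del: eval.simps(6) cong: if_cong)
  \<comment> \<open>Naming the inner sum keeps the simplifier from unfolding it before the fact
    already proved about it applies.\<close>
  define e where
    "e = SumBelow 5 (Cond (Less (Var 5) q_exp) (Cond slot_exp (Num 1) (Num 0)) (Num 0))"
  have 2: "eval xs R (SumBelow 4 (Cond (Less (Var 4) m_exp) (Cond (required_exp 2 4) e
      (Num 0)) (Num 0))) = (\<Sum>r<m. if r \<in> required I (R 2) then
      (\<Sum>s<q. if slot (R 6) (R 2) r s then 1 else 0) else 0)" if "R 2 < n" for R
    using that bounds(3) sum_if_less[of m "length xs" "\<lambda>r. if r \<in> required I (R 2) then
      (\<Sum>s<q. if slot (R 6) (R 2) r s then 1 else 0) else 0"]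
    by (simp add: eval_Cond holds_connectives eval_header holds_required_exp 1[folded e_def]
        del: eval.simps(6) cong: if_cong)
  define e' where
    "e' = SumBelow 4 (Cond (Less (Var 4) m_exp) (Cond (required_exp 2 4) e (Num 0)) (Num 0))"
  show ?thesis
    unfolding count_exp_def e_def[symmetric] e'_def[symmetric]
    using bounds(1) sum_if_less[of n "length xs" "\<lambda>d. if selected (R 6) d then
      (\<Sum>r<m. if r \<in> required I d then (\<Sum>s<q. if slot (R 6) d r s then 1 else 0) else 0) else 0"]
    by (simp add: eval_Cond holds_connectives eval_header holds_selected_exp 2[folded e'_def]
        length_plan del: eval.simps(6) cong: if_cong)
qed

lemma out_entry_prog:
  assumes "R 2 < n" "R 4 < m" "R 5 < q"
  shows "out xs R entry_prog =
    [R 4, R 5, position (R 6) (R 2) - prefix_stock (R 4) (R 5), 1, R 2]"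
  using assms bounds(3) by (simp add: entry_prog_def eval_position_exp eval_prefix_exp)

lemma encode_plan_plan: "encode_plan (plan k) = length (plan k) #
   concat (map (\<lambda>d. if selected k d then
     concat (map (\<lambda>r. if r \<in> required I d then
       concat (map (\<lambda>s. if slot k d r s then
         [r, s, position k d - prefix_stock r s, 1, d] else []) [0..<q]) else []) [0..<m])
     else []) [0..<n])"
  by (simp add: encode_plan_def plan_def map_concat concat_concat_map comp_def
      if_distrib[of "map _"] if_distrib[of concat] cong: if_cong)

lemma out_solve_prog:
  assumes "k < length xs" "best k" "\<And>k'. k' < length xs \<Longrightarrow> best k' \<Longrightarrow> k' = k"
  shows "out xs R solve_prog = encode_plan (plan k)"
proof -
  have 1: "out xs R (For 5 (When (Less (Var 5) q_exp) (When slot_exp entry_prog))) =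
      concat (map (\<lambda>s. if slot (R 6) (R 2) (R 4) s then
         [R 4, s, position (R 6) (R 2) - prefix_stock (R 4) s, 1, R 2] else []) [0..<q])"
    if "R 2 < n" "R 4 < m" for R
    using that concat_map_if_less[OF bounds(2), of "\<lambda>s. if slot (R 6) (R 2) (R 4) s then
         [R 4, s, position (R 6) (R 2) - prefix_stock (R 4) s, 1, R 2] else []"]
    by (simp add: out_When holds_connectives eval_header holds_slot_exp out_entry_prog
        del: out.simps(3) cong: if_cong)
  define c where "c = For 5 (When (Less (Var 5) q_exp) (When slot_exp entry_prog))"
  have 2: "out xs R (For 4 (When (Less (Var 4) m_exp) (When (required_exp 2 4) c))) =
      concat (map (\<lambda>r. if r \<in> required I (R 2) then
       concat (map (\<lambda>s. if slot (R 6) (R 2) r s then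
         [r, s, position (R 6) (R 2) - prefix_stock r s, 1, R 2] else []) [0..<q]) else []) [0..<m])"
    if "R 2 < n" for R
    using that bounds(3) concat_map_if_less[of m "length xs" "\<lambda>r. if r \<in> required I (R 2) then
       concat (map (\<lambda>s. if slot (R 6) (R 2) r s then
         [r, s, position (R 6) (R 2) - prefix_stock r s, 1, R 2] else []) [0..<q]) else []"]
    by (simp add: out_When holds_connectives eval_header holds_required_exp 1[folded c_def]
        del: out.simps(3) cong: if_cong)
  define c' where "c' = For 4 (When (Less (Var 4) m_exp) (When (required_exp 2 4) c))"
  \<comment> \<open>\<open>tl\<close> removes the leading count, which is emitted separately by
    \<open>count_exp\<close>.\<close>
  have 3: "out xs R (For 2 (When (Less (Var 2) n_exp) (When (selected_exp 6) c'))) =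
      tl (encode_plan (plan (R 6)))" for R
    using bounds(1) concat_map_if_less[of n "length xs" "\<lambda>d. if selected (R 6) d then
     concat (map (\<lambda>r. if r \<in> required I d then
       concat (map (\<lambda>s. if slot (R 6) d r s then
         [r, s, position (R 6) d - prefix_stock r s, 1, d] else []) [0..<q]) else []) [0..<m])
     else []"]
    by (simp add: out_When holds_connectives eval_header holds_selected_exp 2[folded c'_def]
        encode_plan_plan del: out.simps(3) cong: if_cong)
  define c'' where "c'' = For 2 (When (Less (Var 2) n_exp) (When (selected_exp 6) c'))"
  have "out xs R solve_prog = concat (map (\<lambda>v. if best v then encode_plan (plan v) else [])
      [0..<length xs])"
    unfolding solve_prog_def c_def[symmetric] c'_def[symmetric] c''_def[symmetric]
    by (simp add: out_When holds_best_exp eval_count_exp 3[folded c''_def] encode_plan_plan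
        del: out.simps(3) cong: if_cong)
  also have "\<dots> = encode_plan (plan k)" by (rule concat_map_unique[where P = best, OF assms])
  finally show ?thesis .
qed

end

section \<open>Optimality\<close>

text \<open>Exchange argument: the top set \<open>B\<close> has exactly \<open>j\<close> elements
  unless it is all of \<open>G\<close>, so \<open>A - B\<close> embeds into \<open>B - A\<close>,
  and each element of \<open>A - B\<close> has rank at least \<open>j\<close>, hence no larger
  weight than its image.\<close>

lemma sum_le_sum_top:
  fixes w :: "'a \<Rightarrow> nat" and rk :: "'a \<Rightarrow> nat"
  assumes "finite G" "inj_on rk G" "rk ` G \<subseteq> {..<card G}"
    and anti: "\<And>a b. a \<in> G \<Longrightarrow> b \<in> G \<Longrightarrow> rk a < rk b \<Longrightarrow> w b \<le> w a"
    and A: "A \<subseteq> G" "card A \<le> j"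
  shows "sum w A \<le> sum w {d \<in> G. rk d < j}"
proof (cases "card G \<le> j")
  case True
  then have "{d \<in> G. rk d < j} = G" using assms(3) by fastforce
  then show ?thesis using A assms(1) by (simp add: sum_mono2)
next
  case False
  define B where "B = {d \<in> G. rk d < j}"
  have fin: "finite A" "finite B" using A assms(1) by (auto simp: B_def finite_subset)
  have "rk ` G = {..<card G}"
    using assms(1-3) by (intro card_subset_eq) (auto simp: card_image)
  have "rk ` B = {..<j}"
  proof
    show "{..<j} \<subseteq> rk ` B"
    proof
      fix v assume v: "v \<in> {..<j}"
      then have "v \<in> rk ` G" using False \<open>rk ` G = {..<card G}\<close> by auto
      then show "v \<in> rk ` B" using v by (auto simp: B_def)
    qed
  qed (auto simp: B_def)
  moreover have "inj_on rk B" using assms(2) by (rule inj_on_subset) (auto simp: B_def)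
  ultimately have "card B = j" by (metis card_image card_lessThan)
  then have "card (A - B) \<le> card (B - A)"
    using A(2) fin card_Diff_subset_Int[of A B] card_Diff_subset_Int[of B A]
    by (simp add: Int_commute diff_le_mono)
  then obtain f where f: "f ` (A - B) \<subseteq> B - A" "inj_on f (A - B)"
    using card_le_inj[of "A - B" "B - A"] fin by auto
  have "w a \<le> w (f a)" if "a \<in> A - B" for a
  proof -
    have "f a \<in> B" using f(1) that by auto
    then show ?thesis using that A(1) anti[of "f a" a] by (auto simp: B_def not_less)
  qed
  then have "sum w (A - B) \<le> (\<Sum>a\<in>A - B. w (f a))" by (rule sum_mono)
  also have "\<dots> = sum w (f ` (A - B))" using f(2) by (simp add: sum.reindex)
  also have "\<dots> \<le> sum w (B - A)" using f(1) fin by (intro sum_mono2) auto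
  finally have "sum w (A - B) + sum w (A \<inter> B) \<le> sum w (B - A) + sum w (A \<inter> B)" by simp
  then show ?thesis
    using sum.Int_Diff[OF fin(1), of w B] sum.Int_Diff[OF fin(2), of w A]
    by (simp add: B_def[symmetric] Int_commute add.commute)
qed

lemma distinct_concat_map:
  assumes "distinct zs" "\<And>x. x \<in> set zs \<Longrightarrow> distinct (f x)"
    "\<And>x y. x \<in> set zs \<Longrightarrow> y \<in> set zs \<Longrightarrow> x \<noteq> y \<Longrightarrow> set (f x) \<inter> set (f y) = {}"
  shows "distinct (concat (map f zs))"
  using assms
proof (induction zs)
  case (Cons z zs)
  have "set (f z) \<inter> set (f y) = {}" if "y \<in> set zs" for y
    by (rule Cons.prems(3)) (use that Cons.prems(1) in auto)
  moreover have "distinct (concat (map f zs))"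
    by (rule Cons.IH) (use Cons.prems in auto)
  ultimately show ?case using Cons.prems(2)[of z] by auto
qed simp

text \<open>Intervals of lengths \<open>c s\<close> laid end to end cover all positions below the
  total; this finds a starting location for every position below the stock.\<close>

lemma ex_prefix_interval:
  fixes c :: "nat \<Rightarrow> nat"
  assumes "j < sum c {..<q}"
  shows "\<exists>s<q. sum c {..<s} \<le> j \<and> j < sum c {..<s} + c s"
  using assms
proof (induction q)
  case (Suc q)
  then show ?case
    by (cases "j < sum c {..<q}") (auto intro: less_SucI simp: not_less)
qed simp

context simultaneous
begin

lemma best_unique:
  assumes "k < length xs" "best k" "k' < length xs" "best k'"
  shows "k' = k"
proof -
  have "threshold_value k' < threshold_value k \<or> threshold_value k' = threshold_value k \<and> k \<le> k'"
    "threshold_value k < threshold_value k' \<or> threshold_value k = threshold_value k' \<and> k' \<le> k"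
    using assms by (auto simp: best_def)
  then show ?thesis by auto
qed

lemma ex_best: "\<exists>k<length xs. best k"
proof -
  define v where "v = Max (threshold_value ` {..<length xs})"
  have "0 \<in> {..<length xs}" unfolding lessThan_iff using bounds(4) by linarith
  then have ne: "{..<length xs} \<noteq> {}" by blast
  have le: "threshold_value k \<le> v" if "k < length xs" for k
    unfolding v_def using that by (intro Max_ge) auto
  have "v \<in> threshold_value ` {..<length xs}"
    unfolding v_def using ne by (intro Max_in) auto
  then have ex: "\<exists>k. k < length xs \<and> threshold_value k = v" by auto
  define k where "k = (LEAST k. k < length xs \<and> threshold_value k = v)"
  have k: "k < length xs \<and> threshold_value k = v"
    unfolding k_def by (rule LeastI_ex[OF ex])
  have "k \<le> k'" if "k' < length xs \<and> threshold_value k' = v" for k'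
    unfolding k_def by (rule Least_le) (rule that)
  then have "best k"
    using k le unfolding best_def by (metis le_neq_implies_less)
  then show ?thesis using k by blast
qed

section \<open>Ranks within a group of equal required sets\<close>

definition group :: "nat set \<Rightarrow> nat set" where
  "group G = {d. d < n \<and> required I d = G}"

lemma finite_group: "finite (group G)"
  by (simp add: group_def)

lemma rank_eq: "d \<in> group G \<Longrightarrow> rank d = card {d' \<in> group G. ahead d' d}"
  unfolding rank_def group_def by (rule arg_cong[where f = card]) auto

lemma rank_less:
  assumes "d \<in> group G" "d' \<in> group G" "ahead d d'"
  shows "rank d < rank d'"
proof -
  \<comment> \<open>Inclusion is transitivity of \<open>ahead\<close>; it is strict because
    \<open>d\<close> lies only in the larger set.\<close>
  have "{x \<in> group G. ahead x d} \<subset> {x \<in> group G. ahead x d'}"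
    using assms by (auto simp: ahead_def)
  then show ?thesis
    unfolding rank_eq[OF assms(1)] rank_eq[OF assms(2)]
    by (rule psubset_card_mono[rotated]) (simp add: finite_group)
qed

lemma ahead_total: "d \<noteq> d' \<Longrightarrow> ahead d d' \<or> ahead d' d"
  by (auto simp: ahead_def)

lemma inj_on_rank: "inj_on rank (group G)"
proof (rule inj_onI, rule ccontr)
  fix d d' assume *: "d \<in> group G" "d' \<in> group G" "rank d = rank d'" "d \<noteq> d'"
  then show False
    using ahead_total[OF *(4)] rank_less[OF *(1,2)] rank_less[OF *(2,1)] by auto
qed

lemma rank_less_card: "rank ` group G \<subseteq> {..<card (group G)}"
proof
  fix v assume "v \<in> rank ` group G"
  then obtain d where d: "d \<in> group G" "v = rank d" by auto
  have "{x \<in> group G. ahead x d} \<subset> group G" using d by (auto simp: ahead_def)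
  then have "rank d < card (group G)"
    unfolding rank_eq[OF d(1)] by (rule psubset_card_mono[OF finite_group])
  then show "v \<in> {..<card (group G)}" using d by simp
qed

lemma reward_antimono_rank:
  assumes "d \<in> group G" "d' \<in> group G" "rank d < rank d'"
  shows "reward I d' \<le> reward I d"
proof -
  have "d \<noteq> d'" using assms(3) by auto
  then have "ahead d d'" using ahead_total rank_less[OF assms(2,1)] assms(3) by fastforce
  then show ?thesis by (auto simp: ahead_def)
qed

text \<open>With a single resource type, every demand counts as requiring all types, so the cases
  \<open>|M_d| = 1\<close> and \<open>M_d = R\<close> are kept apart by the second
  hypothesis.\<close>

lemma required_single:
  assumes "d < n" "required I d \<noteq> rtypes I" "r \<in> required I d"
  shows "required I d = {r}"
proof -
  have "card (required I d) = 1" using one_or_all assms demands by (auto simp: one_or_all_def)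
  then show ?thesis using assms(3) by (auto simp: card_1_singleton_iff)
qed

text \<open>Selected demands that require all types have positions below \<open>k\<close>, all other
  demands have positions at least \<open>k\<close>. Equal positions and a common type thus force the
  same group, where ranks are distinct.\<close>

lemma position_inj:
  assumes "d < n" "d' < n" "selected k d" "selected k d'" "position k d = position k d'"
    "r \<in> required I d" "r \<in> required I d'"
  shows "d = d'"
proof -
  have "required I d = required I d'"
  proof (cases "required I d = rtypes I \<longleftrightarrow> required I d' = rtypes I")
    case True
    then show ?thesis using required_single[of d r] required_single[of d' r] assms by auto
  next
    case False
    then show ?thesis using assms(3-5) by (auto simp: selected_def position_def split: if_splits)
  qed
  then have "rank d = rank d'" "d \<in> group (required I d)" "d' \<in> group (required I d)"
    using assms by (auto simp: position_def group_def)
  then show ?thesis using inj_on_rank by (meson inj_onD)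
qed

section \<open>The plan of a threshold meets exactly the selected demands\<close>

lemma set_plan: "(\<rho>, ds) \<in> set (plan k) \<longleftrightarrow> (\<exists>d r s. d < n \<and> selected k d \<and> r < m \<and>
    r \<in> required I d \<and> s < q \<and> slot k d r s \<and>
    \<rho> = (r, s, position k d - prefix_stock r s) \<and> ds = [d])"
  by (fastforce simp: plan_def split: if_splits)

lemma distinct_plan: "distinct (map fst (plan k))"
proof -
  have eq: "map fst (plan k) = concat (map (\<lambda>d. if selected k d then
     concat (map (\<lambda>r. if r \<in> required I d then
       concat (map (\<lambda>s. if slot k d r s then
         [(r, s, position k d - prefix_stock r s)] else []) [0..<q]) else []) [0..<m])
     else []) [0..<n])"
    by (simp add: plan_def map_concat comp_def if_distrib[of "map _"] cong: if_cong)
  show ?thesis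
    unfolding eq
  proof (rule distinct_concat_map, goal_cases)
    case (2 d)
    have "distinct (concat (map (\<lambda>r. if r \<in> required I d then
       concat (map (\<lambda>s. if slot k d r s then
         [(r, s, position k d - prefix_stock r s)] else []) [0..<q]) else []) [0..<m]))"
    proof (rule distinct_concat_map, goal_cases)
      case (2 r)
      have "distinct (concat (map (\<lambda>s. if slot k d r s then
         [(r, s, position k d - prefix_stock r s)] else []) [0..<q]))"
        by (rule distinct_concat_map) auto
      then show ?case by simp
    qed auto
    then show ?case by simp
  next
    \<comment> \<open>If type, location and number agree, then so do the positions, since
      \<open>slot\<close> guarantees that the subtraction of the prefix is not truncated;
      \<open>position_inj\<close> then gives the contradiction.\<close>
    case (3 d d')
    then have "d < n" "d' < n" "d \<noteq> d'" by auto
    then show ?case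
      using position_inj[of d d' k]
      by (auto simp: slot_def split: if_splits) (metis le_add_diff_inverse)+
  qed auto
qed

lemma starts_subset: "r < m \<Longrightarrow> starts I r \<subseteq> {..<q}"
  using all_starts rtypes by (auto simp: all_starts_def)

lemma slot_resource:
  assumes "r < m" "slot k d r s"
  shows "(r, s, position k d - prefix_stock r s) \<in> resources I"
proof -
  have "position k d - prefix_stock r s < cap r s" using assms(2) by (auto simp: slot_def)
  then show ?thesis using assms(1) by (auto simp: resources_def cap_def rtypes split: if_splits)
qed

lemma paths_of_plan: "d \<in> set (paths_of (plan k) \<rho>) \<longleftrightarrow> (\<rho>, [d]) \<in> set (plan k)"
proof
  assume "d \<in> set (paths_of (plan k) \<rho>)"
  then obtain ds where "map_of (plan k) \<rho> = Some ds" "d \<in> set ds"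
    by (cases "map_of (plan k) \<rho>") (auto simp: paths_of_def)
  then show "(\<rho>, [d]) \<in> set (plan k)"
    using map_of_SomeD[of "plan k" \<rho> ds] set_plan[of \<rho> ds k] by auto
next
  assume "(\<rho>, [d]) \<in> set (plan k)"
  then have "map_of (plan k) \<rho> = Some [d]" using distinct_plan by simp
  then show "d \<in> set (paths_of (plan k) \<rho>)" by (simp add: paths_of_def)
qed

lemma feasible_plan: "feasible I (paths_of (plan k))"
  unfolding feasible_def
proof
  fix \<rho> assume \<rho>: "\<rho> \<in> resources I"
  show "feasible_path I \<rho> (paths_of (plan k) \<rho>)"
  proof (cases "map_of (plan k) \<rho>")
    case None
    then show ?thesis by (cases \<rho>) (simp add: paths_of_def)
  next
    case (Some ds)
    then have "(\<rho>, ds) \<in> set (plan k)" by (rule map_of_SomeD)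
    then obtain d r s where *: "d < n" "r < m" "r \<in> required I d" "s < q"
      "\<rho> = (r, s, position k d - prefix_stock r s)" "ds = [d]"
      unfolding set_plan by blast
    have "travel I (Start s) (Site d) = 0"
      using zero_travel_times * all_starts demands
      by (auto simp: zero_travel_times_def locations_def)
    then show ?thesis
      using * Some demands by (simp add: paths_of_def can_serve_first_def)
  qed
qed

lemma met_plan: "met I (paths_of (plan k)) = {d. d < n \<and> selected k d}"
proof (intro set_eqI iffI)
  fix d assume "d \<in> met I (paths_of (plan k))"
  then have d: "d < n" and
    *: "\<forall>r\<in>required I d. \<exists>s i. d \<in> set (paths_of (plan k) (r, s, i))"
    using demands unfolding met_def by blast+
  \<comment> \<open>Nonempty required sets exclude demands that would be met vacuously.\<close>
  obtain r where "r \<in> required I d" using required_nonempty[OF d] by auto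
  with * obtain s i where "((r, s, i), [d]) \<in> set (plan k)" by (auto simp: paths_of_plan)
  then show "d \<in> {d. d < n \<and> selected k d}" by (auto simp: set_plan)
next
  fix d assume "d \<in> {d. d < n \<and> selected k d}"
  then have d: "d < n" "selected k d" by auto
  have "\<exists>s i. (r, s, i) \<in> resources I \<and> d \<in> set (paths_of (plan k) (r, s, i))"
    if r: "r \<in> required I d" for r
  proof -
    have "position k d < stock r" using d(2) r by (auto simp: selected_def)
    then obtain s where s: "s < q" "slot k d r s"
      using ex_prefix_interval[of "position k d" "cap r" q]
      by (auto simp: stock_def slot_def prefix_stock_def)
    have "r < m" using required_subset[OF d(1)] r by auto
    then show ?thesis
      using slot_resource[OF _ s(2)] d r s unfolding paths_of_plan set_plan by blast
  qed
  then show "d \<in> met I (paths_of (plan k))" using d demands by (auto simp: met_def)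
qed

lemma total_reward_plan: "total_reward I (paths_of (plan k)) = threshold_value k"
proof -
  have eq: "{d. d < n \<and> selected k d} = {d \<in> {..<n}. selected k d}" by auto
  show ?thesis
    unfolding total_reward_def met_plan threshold_value_def eq by (rule sum.inter_filter) simp
qed

section \<open>Upper bound for arbitrary feasible solutions\<close>

lemma feasible_path_singleton:
  assumes "feasible I Q" "(r, s, i) \<in> resources I" "d \<in> set (Q (r, s, i))"
  shows "Q (r, s, i) = [d]"
proof -
  have path: "feasible_path I (r, s, i) (Q (r, s, i))"
    using assms(1,2) unfolding feasible_def by blast
  show ?thesis
  proof (cases "Q (r, s, i)")
    case (Cons x ys)
    show ?thesis
    proof (cases ys)
      \<comment> \<open>A second demand would have to start after an infinite service, but start
        times are finite.\<close>
      case (Cons y zs)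
      with path \<open>Q (r, s, i) = x # ys\<close> have "x \<in> demands I" "can_serve_after I r x y" by auto
      then show ?thesis
        using infinite_service_times
        by (simp add: can_serve_after_def infinite_service_times_def)
    qed (use assms(3) Cons in auto)
  qed (use assms(3) in auto)
qed

text \<open>Each met demand requiring \<open>r\<close> picks a resource of type \<open>r\<close>
  that serves it; the choice is injective because nonempty paths are singletons.\<close>

lemma card_met_le_stock:
  assumes "feasible I Q" "r < m"
  shows "card {d \<in> met I Q. r \<in> required I d} \<le> stock r"
proof -
  have ex: "\<forall>d\<in>{d \<in> met I Q. r \<in> required I d}. \<exists>\<sigma>. (r, \<sigma>) \<in> resources I \<and> d \<in> set (Q (r, \<sigma>))"
  proof
    fix d assume "d \<in> {d \<in> met I Q. r \<in> required I d}"
    then have "\<forall>r\<in>required I d. \<exists>s i. (r, s, i) \<in> resources I \<and> d \<in> set (Q (r, s, i))"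
      and "r \<in> required I d"
      by (simp_all add: met_def)
    then obtain s i where "(r, s, i) \<in> resources I \<and> d \<in> set (Q (r, s, i))" by blast
    then show "\<exists>\<sigma>. (r, \<sigma>) \<in> resources I \<and> d \<in> set (Q (r, \<sigma>))" ..
  qed
  obtain g where g: "\<forall>d\<in>{d \<in> met I Q. r \<in> required I d}.
      (r, g d) \<in> resources I \<and> d \<in> set (Q (r, g d))"
    using bchoice[OF ex] ..
  define S where "S = Sigma (starts I r) (\<lambda>s. {..<capacity I r s})"
  have fin: "finite (starts I r)"
    by (rule finite_subset[OF starts_subset[OF assms(2)]]) simp
  have "card {d \<in> met I Q. r \<in> required I d} \<le> card S"
  proof (rule card_inj_on_le)
    show "inj_on g {d \<in> met I Q. r \<in> required I d}"
    proof (rule inj_onI)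
      fix d d' assume d: "d \<in> {d \<in> met I Q. r \<in> required I d}"
        and d': "d' \<in> {d \<in> met I Q. r \<in> required I d}" and eq: "g d = g d'"
      have path: "Q (r, g d) = [d]" if "d \<in> {d \<in> met I Q. r \<in> required I d}" for d
        using feasible_path_singleton[OF assms(1), of r "fst (g d)" "snd (g d)" d] bspec[OF g that]
        by simp
      have "[d] = Q (r, g d)" by (rule path[OF d, symmetric])
      also have "\<dots> = [d']" unfolding eq by (rule path[OF d'])
      finally show "d = d'" by simp
    qed
    show "g ` {d \<in> met I Q. r \<in> required I d} \<subseteq> S"
    proof
      fix \<sigma> assume "\<sigma> \<in> g ` {d \<in> met I Q. r \<in> required I d}"
      then obtain d where "d \<in> {d \<in> met I Q. r \<in> required I d}" "\<sigma> = g d" by blast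
      then have "(r, \<sigma>) \<in> resources I" using bspec[OF g] by simp
      then show "\<sigma> \<in> S" by (auto simp: S_def resources_def)
    qed
    show "finite S" using fin by (auto simp: S_def)
  qed
  also have "card S = (\<Sum>s\<in>starts I r. capacity I r s)" using fin by (simp add: S_def)
  also have "\<dots> = (\<Sum>s<q. cap r s)"
    using starts_subset[OF assms(2)] fin
    by (intro sum.mono_neutral_cong_left) (auto simp: cap_def)
  finally show ?thesis by (simp add: stock_def)
qed

text \<open>With \<open>k\<close> the number of met demands that require all types, at most
  \<open>stock r - k\<close> met demands require \<open>r\<close> alone. Within each group, the best
  demands under these limits are all selected at threshold \<open>k\<close>.\<close>

lemma total_reward_le:
  assumes "feasible I Q"
  shows "\<exists>k<length xs. total_reward I Q \<le> threshold_value k"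
proof -
  define A where "A = met I Q"
  have A: "A \<subseteq> {..<n}" and finA: "finite A"
    using demands finite_subset[of A "{..<n}"] by (auto simp: A_def met_def)
  define k where "k = card (A \<inter> group (rtypes I))"
  have "k \<le> card {..<n}" unfolding k_def using A by (intro card_mono) auto
  then have k: "k < length xs" using bounds(1) by simp
  have cardA: "card {d \<in> A. r \<in> required I d} \<le> stock r" if "r < m" for r
    using card_met_le_stock[OF assms that] by (simp add: A_def)
  define B where "B = {d \<in> {..<n}. selected k d}"
  have groups: "sum (reward I) {d \<in> A. required I d = G} \<le> sum (reward I) {d \<in> B. required I d = G}"
    if G: "G \<in> required I ` {..<n}" for G
  proof -
    have AG: "{d \<in> A. required I d = G} \<subseteq> group G" using A by (auto simp: group_def)
    have top: "sum (reward I) {d \<in> A. required I d = G} \<le> sum (reward I) {d \<in> group G. rank d < j}"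
      if "card {d \<in> A. required I d = G} \<le> j" for j
      using finite_group inj_on_rank rank_less_card reward_antimono_rank AG that
      by (rule sum_le_sum_top)
    show ?thesis
    proof (cases "G = rtypes I")
      case True
      \<comment> \<open>Each of these \<open>k\<close> demands needs its own resource of every type.
        Hence ranks below \<open>k\<close> also pass the stock condition in
        \<open>selected\<close>.\<close>
      have le: "k \<le> stock r" if "r < m" for r
      proof -
        have "k \<le> card {d \<in> A. r \<in> required I d}"
          unfolding k_def using finA that rtypes by (intro card_mono) (auto simp: group_def)
        then show ?thesis using cardA[OF that] by simp
      qed
      have "{d \<in> A. required I d = G} = A \<inter> group (rtypes I)" using True A by (auto simp: group_def)
      then have "card {d \<in> A. required I d = G} \<le> k" by (simp add: k_def)
      note top[OF this]
      also have "sum (reward I) {d \<in> group G. rank d < k} \<le> sum (reward I) {d \<in> B. required I d = G}"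
      proof (rule sum_mono2)
        show "{d \<in> group G. rank d < k} \<subseteq> {d \<in> B. required I d = G}"
        proof
          fix d assume "d \<in> {d \<in> group G. rank d < k}"
          then have d: "d < n" "required I d = rtypes I" "rank d < k"
            using True by (auto simp: group_def)
          have "rank d < stock r" if "r < m" for r using d(3) le[OF that] by simp
          then show "d \<in> {d \<in> B. required I d = G}"
            using d True rtypes by (simp add: B_def selected_def position_def)
        qed
      qed (simp_all add: B_def)
      finally show ?thesis .
    next
      case False
      obtain d r where "d < n" "G = required I d" "r \<in> G" using G required_nonempty by fastforce
      then have Gr: "G = {r}" and r: "r < m"
        using required_single[of d r] False required_subset[of d] by auto
      \<comment> \<open>Demands for \<open>r\<close> alone and demands for all types are disjoint
        and compete for the same resources of type \<open>r\<close>.\<close>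
      have "card {d \<in> A. required I d = G} + k =
          card ({d \<in> A. required I d = G} \<union> (A \<inter> group (rtypes I)))"
        unfolding k_def using finA False by (intro card_Un_disjoint[symmetric]) (auto simp: group_def)
      also have "\<dots> \<le> card {d \<in> A. r \<in> required I d}"
        using finA Gr r rtypes by (intro card_mono) (auto simp: group_def)
      also have "\<dots> \<le> stock r" by (rule cardA[OF r])
      finally have "card {d \<in> A. required I d = G} \<le> stock r - k" by simp
      note top[OF this]
      also have "sum (reward I) {d \<in> group G. rank d < stock r - k} \<le>
          sum (reward I) {d \<in> B. required I d = G}"
      proof (rule sum_mono2)
        show "{d \<in> group G. rank d < stock r - k} \<subseteq> {d \<in> B. required I d = G}"
        proof
          fix d assume "d \<in> {d \<in> group G. rank d < stock r - k}"
          then have d: "d < n" "required I d = {r}" "k + rank d < stock r"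
            using Gr by (auto simp: group_def)
          then show "d \<in> {d \<in> B. required I d = G}"
            using False Gr by (simp add: B_def selected_def position_def)
        qed
      qed (simp_all add: B_def)
      finally show ?thesis .
    qed
  qed
  have "total_reward I Q = sum (reward I) A" by (simp add: total_reward_def A_def)
  \<comment> \<open>Rewards are split by required set, so that the bounds per group can be added
    up.\<close>
  also have "\<dots> = (\<Sum>G\<in>required I ` {..<n}. sum (reward I) {d \<in> A. required I d = G})"
    by (rule sum.group[symmetric]) (use A finA in auto)
  also have "\<dots> \<le> (\<Sum>G\<in>required I ` {..<n}. sum (reward I) {d \<in> B. required I d = G})"
    by (rule sum_mono) (rule groups)
  also have "\<dots> = sum (reward I) B"
    by (rule sum.group) (auto simp: B_def)
  also have "\<dots> = threshold_value k"
    unfolding B_def threshold_value_def by (rule sum.inter_filter) simp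
  finally show ?thesis using k by blast
qed

lemma out_solve_prog_optimal: "encodes_optimal_solution I (out xs R solve_prog)"
proof -
  obtain k where k: "k < length xs" "best k" using ex_best by blast
  have "optimal I (paths_of (plan k))"
    unfolding optimal_def
  proof (intro conjI allI impI)
    fix Q assume "feasible I Q"
    then obtain k' where "k' < length xs" "total_reward I Q \<le> threshold_value k'"
      using total_reward_le by blast
    moreover have "threshold_value k' \<le> threshold_value k"
      using k(2) \<open>k' < length xs\<close> by (auto simp: best_def)
    ultimately show "total_reward I Q \<le> total_reward I (paths_of (plan k))"
      by (simp add: total_reward_plan)
  qed (rule feasible_plan)
  moreover have "fst ` set (plan k) \<subseteq> resources I"
  proof
    fix \<rho> assume "\<rho> \<in> fst ` set (plan k)"
    then obtain ds where "(\<rho>, ds) \<in> set (plan k)" by auto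
    then show "\<rho> \<in> resources I" using slot_resource unfolding set_plan by blast
  qed
  moreover have "out xs R solve_prog = encode_plan (plan k)"
    by (rule out_solve_prog[OF k best_unique[OF k]])
  ultimately show ?thesis
    unfolding encodes_optimal_solution_def using distinct_plan by blast
qed

end

theorem theorem5:
  shows "solvable_in_polynomial_time
    {I. mrmd_instance I \<and> numbered I \<and> one_or_all I \<and> zero_travel_times I \<and>
        infinite_service_times I \<and> same_start_times I}
    encode_instance encodes_optimal_solution"
proof -
  obtain c p where run: "\<And>xs. \<exists>t \<sigma> R. exec c (initial_state xs) t \<sigma> \<and>
      output_of \<sigma> = out xs R solve_prog \<and>
      t + bit_size (output_of \<sigma>) \<le> poly p (bit_size xs)"
    using prog_in_polynomial_time[OF wf_solve_prog] by auto
  have "\<exists>t \<sigma>. exec c (initial_state (encode_instance I)) t \<sigma> \<and>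
      encodes_optimal_solution I (output_of \<sigma>) \<and>
      t + bit_size (output_of \<sigma>) \<le> poly p (bit_size (encode_instance I))"
    if I: "mrmd_instance I" "numbered I" "one_or_all I" "zero_travel_times I"
      "infinite_service_times I" for I
  proof -
    obtain n m q where "demands I = {..<n}" "rtypes I = {..<m}" "all_starts I = {..<q}"
      using I(2) by (auto simp: numbered_def)
    then interpret simultaneous I n m q by unfold_locales (use I in auto)
    show ?thesis using run[of "encode_instance I"] out_solve_prog_optimal by metis
  qed
  then show ?thesis unfolding solvable_in_polynomial_time_def by blast
qed

end
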